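(* Let $\Lambda=\{0,\dots,N\}\setminus\{k_1,\dots,k_M\}$, where $N$ and $k_1<k_2<\dots<k_M<N$ are positive integers ($M\ge 0$). Suppose that $p\in\mathcal P(\Lambda)$ and $\|p\|_1=1$. Let $\widetilde{\mathcal N}=\ker\widetilde{\mathfrak M}\subset\mathbb R^{2\widetilde m+1}$, where $\widetilde m$ and the real $2M\times(2\widetilde m+1)$ matrix $\widetilde{\mathfrak M}=\widetilde{\mathfrak M}(p)$ are as defined in the context. Then $p$ is an exposed point of $\mathrm{ball}(\mathcal P(\Lambda))$ if and only if $\dim_+\widetilde{\mathcal N}=1$.
   Context: Let $\mathbb T=\{\zeta\in\mathbb C:|\zeta|=1\}$ and $\mathbb D=\{z\in\mathbb C:|z|<1\}$. Let $\mathcal P_N$ be the set of complex polynomials of degree at most $N$, and let $\mathcal P(\Lambda)$ be the complex vector space of polynomials of the form $\sum_{k\in\Lambda}c_kz^k$ with $c_k\in\mathbb C$, normed by $\|f\|_1=\frac1{2\pi}\int_{\mathbb T}|f(\zeta)|\,|d\zeta|$ (restricting polynomials to $\mathbb T$). When $M=0$ the set $\{k_1,\dots,k_M\}$ is empty and $\mathcal P(\Lambda)=\mathcal P_N$. For a complex Banach space $X$, $\mathrm{ball}(X)=\{x\in X:\|x\|\le1\}$. An element $\xi\in\mathrm{ball}(X)$ is an exposed point of $\mathrm{ball}(X)$ if there is a functional $\phi\in X^*$ of norm $1$ with $\{x\in\mathrm{ball}(X):\phi(x)=1\}=\{\xi\}$. For $p(z)=\sum_{k=0}^Nc_kz^k\in\mathcal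 P_N$ put $p^*(z)=\sum_{k=0}^N\overline{c_k}\,z^{N-k}$ (so $p^*(z)=z^N\overline{p(1/\bar z)}$ for $z\ne0$). Construction of $\widetilde m$ and $\widetilde{\mathfrak M}$ from a unit-norm $p\in\mathcal P(\Lambda)$. Let $a_1,\dots,a_n$ ($n\ge0$) be the distinct common zeros of $p$ and $p^*$ lying in $\mathbb D$, let $m_j=\min\{\mathrm{mult}(a_j,p),\mathrm{mult}(a_j,p^* )\}$, where $\mathrm{mult}(a_j,\cdot)$ is the multiplicity of the zero at $a_j$, let $m=\sum_{j=1}^nm_j$, and put $G(z)=\prod_{j=1}^n(z-a_j)^{m_j}(1-\overline{a_j}z)^{m_j}$. Let $\zeta_1,\dots,\zeta_\nu$ ($\nu\ge0$) be the distinct zeros of $p$ lying on $\mathbb T$, with respective multiplicities $\lambda_1,\dots,\lambda_\nu$. Put $\mu_j=[\lambda_j/2]$ (integral part), $\mu=\sum_{j=1}^\nu\mu_j$, $\widetilde m=m+\mu$, $\widetilde s=N-2\widetilde m$, and $$G_0(z)=\prod_{j=1}^\nu(z-\zeta_j)^{\mu_j}(1-\overline{\zeta_j}z)^{\mu_j},\qquad \widetilde G=GG_0,\qquad \widetilde R=p/\widetilde G.$$ Then $\widetilde R$ is a polynomial of degree at most $\widetilde s$. For $k\in\mathbb Z$, let $\widetilde C_k$ be the coefficient of $z^k$ in $\widetilde R$ (with $\widetilde C_k=0$ for $k\notin[0,\widetilde s]$), and let $\widetilde A(k)=\mathrm{Re}\,\widetilde C_k$, $\widetilde B(k)=\mathrm{Im}\,\widetilde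 C_k$. For $j=1,\dots,M$ and $l=0,\dots,\widetilde m$, put $$\widetilde A^{+}_{j,l}=\widetilde A(k_j+l-\widetilde m)+\widetilde A(k_j-l-\widetilde m),\qquad \widetilde B^{+}_{j,l}=\widetilde B(k_j+l-\widetilde m)+\widetilde B(k_j-l-\widetilde m),$$ $$\widetilde A^{-}_{j,l}=\widetilde A(k_j+l-\widetilde m)-\widetilde A(k_j-l-\widetilde m),\qquad \widetilde B^{-}_{j,l}=\widetilde B(k_j+l-\widetilde m)-\widetilde B(k_j-l-\widetilde m).$$ Let $\widetilde{\mathcal A}^+=\{\widetilde A^+_{j,l}\}$ and $\widetilde{\mathcal B}^+=\{\widetilde B^+_{j,l}\}$ be the $M\times(\widetilde m+1)$ matrices with row index $j=1,\dots,M$ and column index $l=0,\dots,\widetilde m$, and let $\widetilde{\mathcal A}^-=\{\widetilde A^-_{j,l}\}$ and $\widetilde{\mathcal B}^-=\{\widetilde B^-_{j,l}\}$ be the $M\times\widetilde m$ matrices with row index $j=1,\dots,M$ and column index $l=1,\dots,\widetilde m$ (absent if $\widetilde m=0$). Put $$\widetilde{\mathfrak M}=\begin{pmatrix}\widetilde{\mathcal A}^+&\widetilde{\mathcal B}^-\\ \widetilde{\mathcal B}^+&-\widetilde{\mathcal A}^-\end{pmatrix},$$ a real matrix with $2M$ rows and $2\widetilde m+1$ columns, viewed as a linear map $\mathbb R^{2\widetilde m+1}\to\mathbb R^{2M}$. If $M=0$, its kernel is all of $\mathbb R^{2\widetilde m+1}$. Plus-dimension: for an integer $d\ge0$, a vector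 $(\alpha,\beta)=(\alpha_0,\alpha_1,\dots,\alpha_d,\beta_1,\dots,\beta_d)\in\mathbb R^{2d+1}$ is called a plus-vector if $\alpha_0+\sum_{k=1}^d(\alpha_k\cos kt-\beta_k\sin kt)\ge0$ for all $t\in(-\pi,\pi]$. For a subspace $V\subset\mathbb R^{2d+1}$, $\dim_+V$ is the maximum number of linearly independent plus-vectors in $V$. *)

theory Defs
  imports "HOL-Analysis.Analysis" "Jordan_Normal_Form.Matrix_Kernel"
begin

hide_const (open) Coset.order

section \<open>Exposed points\<close>

text \<open>
  A complex normed space is given by its carrier \<open>X\<close> inside a type, its scalar multiplication
  \<open>scl\<close> and its norm \<open>nrm\<close>. Only the values of a functional \<open>\<phi>\<close> on \<open>X\<close> matter.
\<close>

definition unit_ball :: "'a set \<Rightarrow> ('a \<Rightarrow> real) \<Rightarrow> 'a set" where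
  "unit_ball X nrm = {x \<in> X. nrm x \<le> 1}"

definition bounded_functional ::
    "(complex \<Rightarrow> 'a::ab_group_add \<Rightarrow> 'a) \<Rightarrow> 'a set \<Rightarrow> ('a \<Rightarrow> real) \<Rightarrow> ('a \<Rightarrow> complex) \<Rightarrow> bool" where
  "bounded_functional scl X nrm \<phi> \<longleftrightarrow>
     (\<forall>x\<in>X. \<forall>y\<in>X. \<phi> (x + y) = \<phi> x + \<phi> y) \<and>
     (\<forall>c. \<forall>x\<in>X. \<phi> (scl c x) = c * \<phi> x) \<and>
     (\<exists>C. \<forall>x\<in>X. cmod (\<phi> x) \<le> C * nrm x)"

definition dual_norm :: "'a set \<Rightarrow> ('a \<Rightarrow> real) \<Rightarrow> ('a \<Rightarrow> complex) \<Rightarrow> real" where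
  "dual_norm X nrm \<phi> = (SUP x\<in>unit_ball X nrm. cmod (\<phi> x))"

definition exposed_point ::
    "(complex \<Rightarrow> 'a::ab_group_add \<Rightarrow> 'a) \<Rightarrow> 'a set \<Rightarrow> ('a \<Rightarrow> real) \<Rightarrow> 'a \<Rightarrow> bool" where
  "exposed_point scl X nrm \<xi> \<longleftrightarrow>
     \<xi> \<in> unit_ball X nrm \<and>
     (\<exists>\<phi>. bounded_functional scl X nrm \<phi> \<and> dual_norm X nrm \<phi> = 1 \<and>
          {x \<in> unit_ball X nrm. \<phi> x = 1} = {\<xi>})"

section \<open>Polynomials with prescribed spectrum\<close>

definition polys_on :: "nat set \<Rightarrow> complex poly set" where
  "polys_on \<Lambda> = {(\<Sum>k\<in>\<Lambda>. monom (c k) k) | c. True}"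

text \<open>The normalised arc length integral over the unit circle, parametrised by \<open>\<zeta> = cis t\<close>.\<close>

definition L1_norm :: "complex poly \<Rightarrow> real" where
  "L1_norm f = 1 / (2 * pi) * integral {-pi..pi} (\<lambda>t. cmod (poly f (cis t)))"

definition star :: "nat \<Rightarrow> complex poly \<Rightarrow> complex poly" where
  "star N p = (\<Sum>k\<le>N. monom (cnj (coeff p k)) (N - k))"

section \<open>The number \<open>m\<^sup>~\<close> and the matrix \<open>M\<^sup>~\<close>\<close>

definition common_zeros :: "nat \<Rightarrow> complex poly \<Rightarrow> complex set" where
  "common_zeros N p = {a. cmod a < 1 \<and> poly p a = 0 \<and> poly (star N p) a = 0}"

definition common_mult :: "nat \<Rightarrow> complex poly \<Rightarrow> complex \<Rightarrow> nat" where
  "common_mult N p a = min (Polynomial.order a p) (Polynomial.order a (star N p))"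

definition circle_zeros :: "complex poly \<Rightarrow> complex set" where
  "circle_zeros p = {\<zeta>. cmod \<zeta> = 1 \<and> poly p \<zeta> = 0}"

definition half_mult :: "complex poly \<Rightarrow> complex \<Rightarrow> nat" where
  "half_mult p \<zeta> = Polynomial.order \<zeta> p div 2"

definition m_tilde :: "nat \<Rightarrow> complex poly \<Rightarrow> nat" where
  "m_tilde N p = (\<Sum>a\<in>common_zeros N p. common_mult N p a) + (\<Sum>\<zeta>\<in>circle_zeros p. half_mult p \<zeta>)"

definition s_tilde :: "nat \<Rightarrow> complex poly \<Rightarrow> int" where
  "s_tilde N p = int N - 2 * int (m_tilde N p)"

definition G_poly :: "nat \<Rightarrow> complex poly \<Rightarrow> complex poly" where
  "G_poly N p =
     (\<Prod>a\<in>common_zeros N p. [:- a, 1:] ^ common_mult N p a * [:1, - cnj a:] ^ common_mult N p a)"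

definition G0_poly :: "complex poly \<Rightarrow> complex poly" where
  "G0_poly p =
     (\<Prod>\<zeta>\<in>circle_zeros p. [:- \<zeta>, 1:] ^ half_mult p \<zeta> * [:1, - cnj \<zeta>:] ^ half_mult p \<zeta>)"

text \<open>For nonzero \<open>p\<close> of degree at most \<open>N\<close> the division is exact: a zero \<open>a \<noteq> 0\<close> of
  \<open>star N p\<close> corresponds to the zero \<open>1 / cnj a\<close> of \<open>p\<close>, with the same multiplicity.\<close>

definition R_tilde :: "nat \<Rightarrow> complex poly \<Rightarrow> complex poly" where
  "R_tilde N p = p div (G_poly N p * G0_poly p)"

definition C_tilde :: "nat \<Rightarrow> complex poly \<Rightarrow> int \<Rightarrow> complex" where
  "C_tilde N p i = (if 0 \<le> i \<and> i \<le> s_tilde N p then coeff (R_tilde N p) (nat i) else 0)"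

definition A_tilde :: "nat \<Rightarrow> complex poly \<Rightarrow> int \<Rightarrow> real" where
  "A_tilde N p i = Re (C_tilde N p i)"

definition B_tilde :: "nat \<Rightarrow> complex poly \<Rightarrow> int \<Rightarrow> real" where
  "B_tilde N p i = Im (C_tilde N p i)"

text \<open>In the following four, \<open>kj\<close> is the omitted exponent \<open>k\<^sub>j\<close> of row \<open>j\<close>.\<close>

definition A_plus :: "nat \<Rightarrow> complex poly \<Rightarrow> nat \<Rightarrow> nat \<Rightarrow> real" where
  "A_plus N p kj l =
     A_tilde N p (int kj + int l - int (m_tilde N p)) + A_tilde N p (int kj - int l - int (m_tilde N p))"

definition B_plus :: "nat \<Rightarrow> complex poly \<Rightarrow> nat \<Rightarrow> nat \<Rightarrow> real" where
  "B_plus N p kj l =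
     B_tilde N p (int kj + int l - int (m_tilde N p)) + B_tilde N p (int kj - int l - int (m_tilde N p))"

definition A_minus :: "nat \<Rightarrow> complex poly \<Rightarrow> nat \<Rightarrow> nat \<Rightarrow> real" where
  "A_minus N p kj l =
     A_tilde N p (int kj + int l - int (m_tilde N p)) - A_tilde N p (int kj - int l - int (m_tilde N p))"

definition B_minus :: "nat \<Rightarrow> complex poly \<Rightarrow> nat \<Rightarrow> nat \<Rightarrow> real" where
  "B_minus N p kj l =
     B_tilde N p (int kj + int l - int (m_tilde N p)) - B_tilde N p (int kj - int l - int (m_tilde N p))"

text \<open>Matrix entries are indexed from 0. Hence row \<open>i\<close> belongs to \<open>j = i + 1\<close>; the columns of the
  plus blocks are \<open>l = 0, \<dots>, m_tilde\<close>, and column \<open>l\<close> of a minus block belongs to \<open>l + 1\<close>.\<close>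

definition M_tilde :: "nat \<Rightarrow> nat \<Rightarrow> (nat \<Rightarrow> nat) \<Rightarrow> complex poly \<Rightarrow> real mat" where
  "M_tilde N M k p =
    (let m = m_tilde N p in
     four_block_mat
       (mat M (m + 1) (\<lambda>(i, l). A_plus N p (k (i + 1)) l))
       (mat M m (\<lambda>(i, l). B_minus N p (k (i + 1)) (l + 1)))
       (mat M (m + 1) (\<lambda>(i, l). B_plus N p (k (i + 1)) l))
       (- mat M m (\<lambda>(i, l). A_minus N p (k (i + 1)) (l + 1))))"

section \<open>Plus-dimension\<close>

text \<open>A vector \<open>v\<close> of dimension \<open>2 * d + 1\<close> has \<open>\<alpha>\<^sub>k\<close> at index \<open>k\<close> for \<open>k = 0, \<dots>, d\<close>
  and \<open>\<beta>\<^sub>k\<close> at index \<open>d + k\<close> for \<open>k = 1, \<dots>, d\<close>.\<close>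

definition plus_vector :: "nat \<Rightarrow> real Matrix.vec \<Rightarrow> bool" where
  "plus_vector d v \<longleftrightarrow>
     v \<in> carrier_vec (2 * d + 1) \<and>
     (\<forall>t\<in>{-pi<..pi}.
        vec_index v 0 +
        (\<Sum>k=1..d. vec_index v k * cos (real k * t) - vec_index v (d + k) * sin (real k * t)) \<ge> 0)"

definition dim_plus :: "nat \<Rightarrow> real Matrix.vec set \<Rightarrow> nat" where
  "dim_plus d V =
     Max {card S | S. finite S \<and> S \<subseteq> V \<and> (\<forall>v\<in>S. plus_vector d v) \<and>
                      \<not> LinearCombinations.module.lin_dep class_ring
                          (module_vec TYPE(real) (2 * d + 1)) S}"

end

theory Submission
  imports Defs "HOL-Computational_Algebra.Fundamental_Theorem_Algebra"
begin

hide_const (open) Module.smult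

text \<open>
  Write \<open>X = polys_on \<Lambda>\<close>, \<open>m = m_tilde N p\<close>, \<open>R = R_tilde N p\<close>, and let \<open>K\<close> be the cone of all
  \<open>f \<in> X\<close> with \<open>f \<cdot> cnj p \<ge> 0\<close> on the unit circle. Both sides of the equivalence say that \<open>K\<close>
  is contained in the real line through \<open>p\<close>.

  Exposedness. Since \<open>p\<close> has finitely many zeros on the circle, the norm is differentiable at \<open>p\<close>, and
  the only functional of norm 1 that takes the value 1 at \<open>p\<close> is integration against \<open>cnj (sgn p)\<close>.
  Its value at \<open>f\<close> is the norm of \<open>f\<close> exactly if \<open>f \<cdot> cnj p \<ge> 0\<close>, so \<open>p\<close> is exposed iff every
  \<open>f \<in> K\<close> is a real multiple of \<open>p\<close> (\<open>exposed_point_iff_aligned\<close>).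

  Factorisation. If \<open>f \<cdot> cnj p\<close> is real on the circle, then \<open>f p\<^sup>* = f\<^sup>* p\<close> as polynomials. Comparing
  multiplicities in this identity bounds the order of \<open>f\<close> from below at each zero of \<open>R\<close> off the circle.
  On the circle \<open>R\<close> has only simple zeros, at the zeros of \<open>p\<close> of odd order, and \<open>f\<close> vanishes there
  because \<open>f \<cdot> cnj p\<close> does not change sign (\<open>even_order_if_nonneg_on_circle\<close>). Hence \<open>f = R q\<close>, and
  the orders at 0 give \<open>degree q \<le> 2 m\<close> (\<open>aligned_factor\<close>). On the circle \<open>p / R\<close> is \<open>z\<^sup>m\<close> times a
  nonnegative function, so the sign condition on \<open>f\<close> becomes \<open>cnj z\<^sup>m q(z) \<ge> 0\<close> (\<open>aligned_iff\<close>).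

  Linear algebra. The polynomials \<open>q\<close> of degree at most \<open>2 m\<close> with \<open>cnj z\<^sup>m q(z) \<ge> 0\<close> on the circle
  correspond to the plus-vectors, and a plus-vector lies in the kernel of \<open>M_tilde\<close> iff the coefficients
  of \<open>R q\<close> at the omitted exponents vanish (\<open>mat_kernel_M_tilde_iff\<close>). So \<open>K\<close> corresponds to the
  plus-vectors in the kernel by a real linear injection. One of these, the vector of \<open>p\<close> itself, is
  nonzero, hence the plus-dimension is 1 iff all of them are multiples of it (\<open>dim_plus_eq_1_iff\<close>).
\<close>

section \<open>Exposed points of the unit ball and the phase of a polynomial\<close>

text \<open>\<open>f\<close> and \<open>p\<close> have the same phase at every point of the unit circle where neither vanishes.\<close>

definition aligned :: "complex poly \<Rightarrow> complex poly \<Rightarrow> bool" where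
  "aligned f p \<longleftrightarrow> (\<forall>z. cmod z = 1 \<longrightarrow> poly f z * cnj (poly p z) \<in> \<real>\<^sub>\<ge>\<^sub>0)"

lemma integrable_cmod_poly_cis: "(\<lambda>t. cmod (poly f (cis t))) integrable_on {-pi..pi}"
  by (intro integrable_continuous_interval continuous_intros)

lemma L1_norm_nonneg: "L1_norm f \<ge> 0"
  unfolding L1_norm_def by (intro mult_nonneg_nonneg integral_nonneg integrable_cmod_poly_cis) auto

lemma L1_norm_smult: "L1_norm (smult c f) = cmod c * L1_norm f"
  by (simp add: L1_norm_def norm_mult)

lemma L1_norm_0 [simp]: "L1_norm 0 = 0"
  by (simp add: L1_norm_def)

lemma cis_Arg_unit: "cmod z = 1 \<Longrightarrow> cis (Arg z) = z"
  by (cases "z = 0") (auto simp: cis_Arg sgn_div_norm)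

lemma finite_zeros_cis:
  assumes "p \<noteq> 0"
  shows "finite {t \<in> {-pi..pi}. poly p (cis t) = 0}"
proof (rule finite_subset)
  show "{t \<in> {-pi..pi}. poly p (cis t) = 0} \<subseteq> insert (-pi) (Arg ` {z. poly p z = 0})"
  proof
    fix t assume t: "t \<in> {t \<in> {-pi..pi}. poly p (cis t) = 0}"
    show "t \<in> insert (-pi) (Arg ` {z. poly p z = 0})"
    proof (cases "t = -pi")
      case False
      then have "Arg (cis t) = t" using t by (intro cis_Arg_unique) (auto simp: sgn_if sgn_eq)
      then show ?thesis using t by (metis (mono_tags, lifting) imageI insertCI mem_Collect_eq)
    qed simp
  qed
  show "finite (insert (-pi) (Arg ` {z. poly p z = 0}))"
    using poly_roots_finite[OF assms] by simp
qed

lemma poly_eqI_circle: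
  fixes f g :: "complex poly"
  assumes "\<And>z. cmod z = 1 \<Longrightarrow> poly f z = poly g z"
  shows "f = g"
proof (rule ccontr)
  assume "f \<noteq> g"
  then have "finite {t \<in> {-pi..pi}. poly (f - g) (cis t) = 0}"
    by (intro finite_zeros_cis) simp
  moreover have "{t \<in> {-pi..pi}. poly (f - g) (cis t) = 0} = {-pi..pi}"
    using assms by auto
  ultimately show False by (metis infinite_Icc_iff pi_gt_zero neg_less_iff_less minus_zero less_trans)
qed

lemma L1_norm_eq_0_iff: "L1_norm f = 0 \<longleftrightarrow> f = 0"
proof
  assume "L1_norm f = 0"
  then have "integral {-pi..pi} (\<lambda>t. cmod (poly f (cis t))) = 0"
    by (simp add: L1_norm_def)
  then have z: "\<forall>t\<in>{-pi..pi}. cmod (poly f (cis t)) = 0"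
    by (subst (asm) integral_eq_0_iff) (auto intro!: continuous_intros)
  show "f = 0"
  proof (rule poly_eqI_circle)
    fix z assume "cmod z = 1"
    then have "z = cis (Arg z)"
      by (simp add: cis_Arg_unit)
    then show "poly f z = poly 0 z" using z Arg_bounded[of z]
      by (metis atLeastAtMost_iff less_imp_le norm_eq_zero poly_0)
  qed
qed simp

text \<open>
  Integration against the conjugate of the phase \<open>sgn p\<close> over the circle with normalised arc length.
  The phase is 0 at the zeros of \<open>p\<close>, which form a null set when \<open>p \<noteq> 0\<close>.\<close>

definition phase_functional :: "complex poly \<Rightarrow> complex poly \<Rightarrow> complex" where
  "phase_functional p f =
     of_real (1 / (2 * pi)) * integral {-pi..pi} (\<lambda>t. poly f (cis t) * cnj (sgn (poly p (cis t))))"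

lemma integrable_phase:
  "(\<lambda>t. poly f (cis t) * cnj (sgn (poly p (cis t)))) integrable_on {-pi..pi}"
proof -
  have c: "(\<lambda>t. poly q (cis t)) \<in> borel_measurable borel" for q :: "complex poly"
    by (intro borel_measurable_continuous_onI continuous_intros)
  have "cnj \<in> borel_measurable borel"
    by (intro borel_measurable_continuous_onI continuous_intros)
  then have "(\<lambda>t. poly f (cis t) * cnj (poly p (cis t) /\<^sub>R cmod (poly p (cis t)))) \<in> borel_measurable borel"
    using c[of f] c[of p] by measurable
  then have "(\<lambda>t. poly f (cis t) * cnj (sgn (poly p (cis t)))) \<in> borel_measurable borel"
    by (simp add: sgn_div_norm)
  then have m: "(\<lambda>t. poly f (cis t) * cnj (sgn (poly p (cis t)))) \<in> borel_measurable (lebesgue_on {-pi..pi})"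
    by (intro measurable_restrict_space1 measurable_completion) simp
  show ?thesis
    by (rule measurable_bounded_by_integrable_imp_integrable[OF m integrable_cmod_poly_cis[of f]])
       (auto simp: norm_mult norm_sgn)
qed

lemma phase_functional_add: "phase_functional p (f + g) = phase_functional p f + phase_functional p g"
  by (simp add: phase_functional_def distrib_right distrib_left integrable_phase
      Henstock_Kurzweil_Integration.integral_add)

lemma phase_functional_smult: "phase_functional p (smult c f) = c * phase_functional p f"
  by (simp add: phase_functional_def mult.assoc)

lemma cmod_phase_functional_le: "cmod (phase_functional p f) \<le> L1_norm f"
proof -
  have "cmod (integral {-pi..pi} (\<lambda>t. poly f (cis t) * cnj (sgn (poly p (cis t)))))
      \<le> integral {-pi..pi} (\<lambda>t. cmod (poly f (cis t)))"
    by (rule integral_norm_bound_integral[OF integrable_phase integrable_cmod_poly_cis])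
       (auto simp: norm_mult norm_sgn)
  then show ?thesis
    by (simp add: phase_functional_def L1_norm_def norm_mult norm_divide divide_right_mono)
qed

lemma phase_functional_self: "phase_functional p p = of_real (L1_norm p)"
proof -
  have "z * cnj (sgn z) = of_real (cmod z)" for z
  proof -
    have "z * cnj (sgn z) = z * cnj z / of_real (cmod z)"
      by (simp add: sgn_div_norm scaleR_conv_of_real field_simps)
    then show ?thesis by (simp add: complex_norm_square[symmetric] power2_eq_square)
  qed
  then have "integral {-pi..pi} (\<lambda>t. poly p (cis t) * cnj (sgn (poly p (cis t))))
     = integral {-pi..pi} (\<lambda>t. of_real (cmod (poly p (cis t))))"
    by simp
  also have "\<dots> = of_real (integral {-pi..pi} (\<lambda>t. cmod (poly p (cis t))))"
    by (rule integral_unique[OF has_integral_of_real[OF integrable_integral[OF integrable_cmod_poly_cis]]])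
  finally show ?thesis by (simp add: phase_functional_def L1_norm_def)
qed

lemma aligned_if_phase_functional_eq_1:
  assumes "phase_functional p f = 1" "L1_norm f \<le> 1"
  shows "aligned f p"
proof -
  let ?I = "\<lambda>h. integral {-pi..pi} h"
  define F where "F t = poly f (cis t)" for t
  define P where "P t = poly p (cis t)" for t
  define g where "g t = cmod (F t) - Re (F t * cnj (sgn (P t)))" for t
  \<comment> \<open>The defect \<open>g\<close> in the triangle inequality is discontinuous at the zeros of \<open>p\<close>;
    its multiple \<open>h = \<bar>p\<bar> g\<close> is continuous, so it vanishes everywhere once its integral is 0.\<close>
  define h where "h t = cmod (F t) * cmod (P t) - Re (F t * cnj (P t))" for t
  have cF: "continuous_on A F" and cP: "continuous_on A P" for A
    unfolding F_def P_def by (intro continuous_intros)+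
  have iF: "(\<lambda>t. cmod (F t)) integrable_on {-pi..pi}"
    unfolding F_def by (rule integrable_cmod_poly_cis)
  have iR: "((\<lambda>t. Re (F t * cnj (sgn (P t)))) has_integral 2 * pi) {-pi..pi}"
  proof -
    have "((\<lambda>t. F t * cnj (sgn (P t))) has_integral ?I (\<lambda>t. F t * cnj (sgn (P t)))) {-pi..pi}"
      unfolding F_def P_def using integrable_phase by (rule integrable_integral)
    moreover have "?I (\<lambda>t. F t * cnj (sgn (P t))) = of_real (2 * pi)"
      using assms(1) by (simp add: phase_functional_def F_def P_def field_simps)
    ultimately have "((\<lambda>t. F t * cnj (sgn (P t))) has_integral of_real (2 * pi)) {-pi..pi}"
      by simp
    from has_integral_linear[OF this bounded_linear_Re] show ?thesis by (simp add: o_def)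
  qed
  have ig: "g integrable_on {-pi..pi}"
    unfolding g_def by (rule integrable_diff[OF iF has_integral_integrable[OF iR]])
  have "?I g = ?I (\<lambda>t. cmod (F t)) - 2 * pi"
    unfolding g_def
    using Henstock_Kurzweil_Integration.integral_diff[OF iF has_integral_integrable[OF iR]]
      integral_unique[OF iR] by simp
  also have "\<dots> \<le> 0"
    using assms(2) by (simp add: L1_norm_def F_def field_simps)
  finally have g0: "?I g \<le> 0" .
  have gnn: "g t \<ge> 0" for t
  proof -
    have "Re (F t * cnj (sgn (P t))) \<le> cmod (F t * cnj (sgn (P t)))" by (rule complex_Re_le_cmod)
    also have "\<dots> \<le> cmod (F t)" by (simp add: norm_mult norm_sgn)
    finally show ?thesis by (simp add: g_def)
  qed
  have hg: "h t = cmod (P t) * g t" for t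
    by (cases "P t = 0") (auto simp: h_def g_def sgn_div_norm right_diff_distrib mult.commute field_simps)
  have ch: "continuous_on {-pi..pi} h"
    unfolding h_def by (intro continuous_intros cF cP)
  obtain C where C: "\<And>t. t \<in> {-pi..pi} \<Longrightarrow> cmod (P t) \<le> C"
    using compact_imp_bounded[OF compact_continuous_image[OF cP compact_Icc]]
    by (force simp: bounded_iff)
  have ih: "h integrable_on {-pi..pi}" by (rule integrable_continuous_interval[OF ch])
  have "?I h \<le> ?I (\<lambda>t. C * g t)"
  proof (rule integral_le[OF ih integrable_on_mult_right[OF ig]])
    fix t assume "t \<in> {-pi..pi}"
    then show "h t \<le> C * g t" unfolding hg using C gnn by (intro mult_right_mono) auto
  qed
  also have "\<dots> = C * ?I g" by simp
  also have "\<dots> = 0"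
    using antisym[OF g0 integral_nonneg[OF ig]] gnn by simp
  finally have "?I h = 0"
    using integral_nonneg[OF integrable_continuous_interval[OF ch]] gnn by (force simp: hg)
  then have h0: "\<forall>t\<in>{-pi..pi}. h t = 0"
    by (subst (asm) integral_eq_0_iff) (use ch gnn in \<open>auto simp: hg\<close>)
  show ?thesis unfolding aligned_def
  proof (intro allI impI)
    fix z :: complex assume "cmod z = 1"
    then have z: "z = cis (Arg z)"
      by (simp add: cis_Arg_unit)
    have "h (Arg z) = 0" using h0 Arg_bounded[of z] by auto
    then have "cmod (poly f z * cnj (poly p z)) = Re (poly f z * cnj (poly p z))"
      unfolding h_def F_def P_def using z by (simp add: norm_mult)
    then show "poly f z * cnj (poly p z) \<in> \<real>\<^sub>\<ge>\<^sub>0" by (simp only: norm_eq_Re_iff)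
  qed
qed

text \<open>Where \<open>f = u p\<close> with real \<open>u \<ge> 0\<close>, the left-hand side is \<open>\<bar>n - u\<bar> \<bar>p\<bar>\<close>.\<close>

lemma norm_scaled_difference_aligned:
  assumes "aligned f p"
    and "cmod z = 1"
  shows "cmod (of_nat n * poly p z - poly f z) =
    real n * cmod (poly p z) - cmod (poly f z) + 2 * max 0 (cmod (poly f z) - real n * cmod (poly p z))"
proof (cases "poly p z = 0")
  case False
  define w where "w = poly p z"
  define r where "r = poly f z * cnj w"
  have "r \<in> \<real>\<^sub>\<ge>\<^sub>0" using assms unfolding aligned_def r_def w_def by blast
  then obtain s where s: "r = of_real s" "s \<ge> 0" by (metis nonneg_Reals_cases)
  have w: "w \<noteq> 0" using False by (simp add: w_def)
  have "poly f z = (s / (cmod w)\<^sup>2) *\<^sub>R w"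
  proof -
    have "poly f z * (w * cnj w) = of_real s * w" using s(1) unfolding r_def by (metis mult.assoc mult.commute)
    then show ?thesis using w unfolding complex_norm_square[symmetric] scaleR_conv_of_real
      by (simp add: field_simps)
  qed
  then obtain u where u: "poly f z = u *\<^sub>R w" "u \<ge> 0" using s(2) by (metis zero_le_divide_iff zero_le_power2)
  have "cmod (of_nat n * w - u *\<^sub>R w) = \<bar>real n - u\<bar> * cmod w"
    by (metis norm_scaleR scaleR_conv_of_real scaleR_diff_left of_real_of_nat_eq)
  moreover have "max 0 (u * cmod w - real n * cmod w) = max 0 (u - real n) * cmod w"
    by (simp add: max_mult_distrib_right left_diff_distrib)
  ultimately show ?thesis unfolding w_def[symmetric] u(1) using u(2)
    by (auto simp: max_def abs_if algebra_simps)
qed simp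

text \<open>
  Directional differentiability of the norm at \<open>p\<close>, with step \<open>1 / n\<close> and scaled by \<open>n\<close>:
  the norm of \<open>p - f / n\<close> is \<open>L1_norm p - L1_norm f / n\<close> up to \<open>o(1 / n)\<close>.\<close>

lemma L1_norm_scaled_difference_limit:
  assumes "aligned f p" and "p \<noteq> 0"
  shows "(\<lambda>n. L1_norm (smult (of_nat n) p - f) - (real n * L1_norm p - L1_norm f)) \<longlonglongrightarrow> 0"
proof -
  let ?I = "\<lambda>h. integral {-pi..pi} h"
  define F where "F t = cmod (poly f (cis t))" for t
  define P where "P t = cmod (poly p (cis t))" for t
  define h where "h n t = max 0 (F t - real n * P t)" for n t
  define Z where "Z = {t \<in> {-pi..pi}. poly p (cis t) = 0}"
  have cF: "continuous_on A F" and cP: "continuous_on A P" for A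
    unfolding F_def P_def by (intro continuous_intros)+
  have iF: "F integrable_on {-pi..pi}" and iP: "P integrable_on {-pi..pi}"
    by (intro integrable_continuous_interval cF cP)+
  have ih: "h n integrable_on {-pi..pi}" for n
    unfolding h_def by (intro integrable_continuous_interval continuous_intros cF cP)
  have eq: "L1_norm (smult (of_nat n) p - f) - (real n * L1_norm p - L1_norm f) = 2 / (2 * pi) * ?I (h n)" for n
  proof -
    have "?I (\<lambda>t. cmod (poly (smult (of_nat n) p - f) (cis t))) = ?I (\<lambda>t. (real n * P t - F t) + 2 * h n t)"
      by (rule arg_cong[where f = ?I])
         (auto simp: h_def F_def P_def norm_scaled_difference_aligned[OF assms(1)])
    also have "\<dots> = (real n * ?I P - ?I F) + 2 * ?I (h n)"
      by (intro integral_unique has_integral_add has_integral_diff has_integral_mult_right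
          integrable_integral iF iP ih)
    finally show ?thesis
      by (simp add: L1_norm_def F_def[abs_def] P_def[abs_def] field_simps)
  qed
  \<comment> \<open>The integrands \<open>h n\<close> are bounded by \<open>F\<close> and are eventually 0 at each point outside the null set \<open>Z\<close>.\<close>
  have Z: "finite Z" unfolding Z_def by (rule finite_zeros_cis[OF assms(2)])
  have sp: "?I (h n) = ?I (\<lambda>t. if t \<in> Z then 0 else h n t)" for n
    by (rule integral_spike[of Z]) (auto simp: Z negligible_finite)
  have "(\<lambda>n. ?I (\<lambda>t. if t \<in> Z then 0 else h n t)) \<longlonglongrightarrow> ?I (\<lambda>t. 0)"
  proof (rule dominated_convergence(2)[OF _ iF])
    show "(\<lambda>t. if t \<in> Z then 0 else h n t) integrable_on {-pi..pi}" for n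
      by (rule integrable_spike_finite[OF Z _ ih[of n]]) auto
    show "norm (if t \<in> Z then 0 else h n t) \<le> F t" for n t
      by (auto simp: h_def F_def P_def max_def)
    show "(\<lambda>n. if t \<in> Z then 0 else h n t) \<longlonglongrightarrow> 0" if "t \<in> {-pi..pi}" for t
    proof (cases "t \<in> Z")
      case False
      then have "P t > 0" using that by (auto simp: Z_def P_def)
      then obtain m where m: "F t < real m * P t" using reals_Archimedean3 by blast
      have "h n t = 0" if "n \<ge> m" for n
      proof -
        have "real m * P t \<le> real n * P t" using that \<open>P t > 0\<close> by simp
        then show ?thesis using m by (simp add: h_def)
      qed
      then have "eventually (\<lambda>n. (if t \<in> Z then 0 else h n t) = 0) sequentially"
        by (auto simp: eventually_sequentially)
      then show ?thesis by (rule tendsto_eventually)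
    qed simp
  qed
  then have "(\<lambda>n. ?I (h n)) \<longlonglongrightarrow> 0" by (simp add: sp)
  then have "(\<lambda>n. 2 / (2 * pi) * ?I (h n)) \<longlonglongrightarrow> 2 / (2 * pi) * 0"
    by (intro tendsto_intros)
  then show ?thesis by (simp add: eq)
qed

lemma functional_le_L1_norm:
  assumes \<phi>: "bounded_functional smult X L1_norm \<phi>" and "dual_norm X L1_norm \<phi> = 1"
    and smult: "\<And>c x. x \<in> X \<Longrightarrow> smult c x \<in> X"
    and x: "x \<in> X"
  shows "cmod (\<phi> x) \<le> L1_norm x"
proof -
  have hom: "\<phi> (smult c x) = c * \<phi> x" for c using \<phi> x by (simp add: bounded_functional_def)
  obtain C where C: "\<And>x. x \<in> X \<Longrightarrow> cmod (\<phi> x) \<le> C * L1_norm x"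
    using \<phi> unfolding bounded_functional_def by blast
  have bdd: "bdd_above ((\<lambda>x. cmod (\<phi> x)) ` unit_ball X L1_norm)"
  proof (rule bdd_aboveI2)
    fix y assume y: "y \<in> unit_ball X L1_norm"
    then have "cmod (\<phi> y) \<le> C * L1_norm y" using C by (simp add: unit_ball_def)
    also have "\<dots> \<le> \<bar>C\<bar> * L1_norm y" by (intro mult_right_mono L1_norm_nonneg) auto
    also have "\<dots> \<le> \<bar>C\<bar> * 1" using y by (intro mult_left_mono) (auto simp: unit_ball_def)
    finally show "cmod (\<phi> y) \<le> \<bar>C\<bar>" by simp
  qed
  show ?thesis
  proof (cases "x = 0")
    case True
    then show ?thesis using hom[of 0] by simp
  next
    case False
    then have pos: "L1_norm x > 0" using L1_norm_nonneg[of x] L1_norm_eq_0_iff[of x] by linarith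
    define y where "y = smult (of_real (1 / L1_norm x)) x"
    have "y \<in> unit_ball X L1_norm"
      using pos by (simp add: y_def unit_ball_def smult[OF x] L1_norm_smult norm_divide)
    then have "cmod (\<phi> y) \<le> 1"
      using cSUP_upper[OF _ bdd] assms(2) by (simp add: dual_norm_def)
    then show ?thesis unfolding y_def hom using pos by (simp add: norm_mult norm_divide field_simps)
  qed
qed

text \<open>Any functional that exposes \<open>p\<close> takes the value \<open>L1_norm f\<close> at every \<open>f\<close> aligned with \<open>p\<close>,
  by differentiability of the norm at \<open>p\<close>. Conversely, if only real multiples of \<open>p\<close> are aligned
  with \<open>p\<close>, then the phase functional exposes \<open>p\<close>.\<close>

lemma exposed_point_iff_aligned:
  assumes add: "\<And>x y. x \<in> X \<Longrightarrow> y \<in> X \<Longrightarrow> x + y \<in> X"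
    and smult: "\<And>c x. x \<in> X \<Longrightarrow> smult c x \<in> X"
    and p: "p \<in> X" "L1_norm p = 1"
  shows "exposed_point smult X L1_norm p \<longleftrightarrow>
    (\<forall>f\<in>X. aligned f p \<longrightarrow> (\<exists>c::real. f = smult (of_real c) p))"
proof
  assume "exposed_point smult X L1_norm p"
  then obtain \<phi> where \<phi>: "bounded_functional smult X L1_norm \<phi>" "dual_norm X L1_norm \<phi> = 1"
    and peak: "{x \<in> unit_ball X L1_norm. \<phi> x = 1} = {p}"
    by (auto simp: exposed_point_def)
  have \<phi>_le: "cmod (\<phi> x) \<le> L1_norm x" if "x \<in> X" for x
    by (rule functional_le_L1_norm[OF \<phi> smult that])
  have \<phi>_add: "\<phi> (x + y) = \<phi> x + \<phi> y" if "x \<in> X" "y \<in> X" for x y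
    using \<phi>(1) that by (simp add: bounded_functional_def)
  have \<phi>_smult: "\<phi> (smult c x) = c * \<phi> x" if "x \<in> X" for c x
    using \<phi>(1) that by (simp add: bounded_functional_def)
  have \<phi>p: "\<phi> p = 1" using peak by blast
  have "p \<noteq> 0" using p(2) by auto
  show "\<forall>f\<in>X. aligned f p \<longrightarrow> (\<exists>c::real. f = smult (of_real c) p)"
  proof (intro ballI impI)
    fix f assume f: "f \<in> X" and al: "aligned f p"
    have lim: "(\<lambda>n. L1_norm (smult (of_nat n) p - f) - (real n * L1_norm p - L1_norm f)) \<longlonglongrightarrow> 0"
      by (rule L1_norm_scaled_difference_limit[OF al \<open>p \<noteq> 0\<close>])
    \<comment> \<open>Apply the functional to \<open>n p - f\<close> and use that it is bounded by the norm.\<close>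
    have "L1_norm f - Re (\<phi> f) \<le> L1_norm (smult (of_nat n) p - f) - (real n * L1_norm p - L1_norm f)" for n
    proof -
      have "smult (of_nat n) p - f = smult (of_nat n) p + smult (-1) f" by simp
      then have mem: "smult (of_nat n) p - f \<in> X" and "\<phi> (smult (of_nat n) p - f) = of_nat n * \<phi> p - \<phi> f"
        using \<phi>_add[OF smult[OF p(1)] smult[OF f]] \<phi>_smult[OF p(1)] \<phi>_smult[OF f]
          add[OF smult[OF p(1)] smult[OF f]]
        by (metis, metis diff_conv_add_uminus mult_minus1)
      then have "real n - Re (\<phi> f) \<le> cmod (\<phi> (smult (of_nat n) p - f))"
        using complex_Re_le_cmod[of "of_nat n - \<phi> f"] by (simp add: \<phi>p)
      also have "\<dots> \<le> L1_norm (smult (of_nat n) p - f)" by (rule \<phi>_le[OF mem])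
      finally show ?thesis using p(2) by simp
    qed
    then have "L1_norm f - Re (\<phi> f) \<le> 0"
      by (intro LIMSEQ_le_const[OF lim]) auto
    then have Re: "Re (\<phi> f) \<ge> L1_norm f" by simp
    have "cmod (\<phi> f) \<le> L1_norm f" by (rule \<phi>_le[OF f])
    then have \<phi>f: "\<phi> f = of_real (L1_norm f)"
      using Re by (metis Re_complex_of_real antisym complex_Re_le_cmod complex_eq_iff complex_is_Real_iff 
         norm_eq_Re_iff complex_nonneg_Reals_iff Im_complex_of_real order_trans)
    show "\<exists>c::real. f = smult (of_real c) p"
    proof (cases "f = 0")
      case True
      then show ?thesis by (intro exI[of _ 0]) simp
    next
      case False
      then have nz: "L1_norm f \<noteq> 0" by (simp add: L1_norm_eq_0_iff)
      define g where "g = smult (of_real (1 / L1_norm f)) f"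
      have "g \<in> unit_ball X L1_norm" "\<phi> g = 1"
        using nz L1_norm_nonneg[of f] by (auto simp: g_def unit_ball_def smult[OF f] L1_norm_smult norm_divide \<phi>_smult[OF f] \<phi>f)
      then have "g = p" using peak by blast
      then have "f = smult (of_real (L1_norm f)) p" using nz by (auto simp: g_def)
      then show ?thesis by blast
    qed
  qed
next
  assume R: "\<forall>f\<in>X. aligned f p \<longrightarrow> (\<exists>c::real. f = smult (of_real c) p)"
  let ?\<phi> = "phase_functional p"
  have p1: "?\<phi> p = 1" by (simp add: phase_functional_self p(2))
  have pb: "p \<in> unit_ball X L1_norm" using p by (simp add: unit_ball_def)
  have "bounded_functional smult X L1_norm ?\<phi>"
    unfolding bounded_functional_def
    by (intro conjI ballI allI exI[of _ 1])
      (simp_all add: phase_functional_add phase_functional_smult cmod_phase_functional_le)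
  moreover have "dual_norm X L1_norm ?\<phi> = 1"
    unfolding dual_norm_def
  proof (rule cSup_eq_maximum)
    show "1 \<in> (\<lambda>x. cmod (?\<phi> x)) ` unit_ball X L1_norm"
      by (rule image_eqI[of _ _ p]) (use pb p1 in simp_all)
    show "y \<le> 1" if "y \<in> (\<lambda>x. cmod (?\<phi> x)) ` unit_ball X L1_norm" for y
    proof -
      from that obtain x where "y = cmod (?\<phi> x)" "L1_norm x \<le> 1" by (auto simp: unit_ball_def)
      then show ?thesis using cmod_phase_functional_le[of p x] by linarith
    qed
  qed
  moreover have "{x \<in> unit_ball X L1_norm. ?\<phi> x = 1} = {p}"
  proof (intro equalityI subsetI)
    fix x assume "x \<in> {x \<in> unit_ball X L1_norm. ?\<phi> x = 1}"
    then have x: "x \<in> X" "L1_norm x \<le> 1" "?\<phi> x = 1" by (auto simp: unit_ball_def)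
    then obtain c :: real where c: "x = smult (of_real c) p"
      using R aligned_if_phase_functional_eq_1 by blast
    then have "of_real c = (1::complex)" using x(3) p1 by (simp add: phase_functional_smult)
    then show "x \<in> {p}" using c by simp
  qed (use pb p1 in auto)
  ultimately show "exposed_point smult X L1_norm p"
    using pb unfolding exposed_point_def by blast
qed

section \<open>The reversed polynomial and orders of zeros\<close>

lemma coeff_star: "coeff (star N p) j = (if j \<le> N then cnj (coeff p (N - j)) else 0)"
proof -
  have "coeff (star N p) j = (\<Sum>k\<le>N. if j = N - k then cnj (coeff p k) else 0)"
    unfolding star_def coeff_sum by (intro sum.cong) (auto)
  also have "\<dots> = (\<Sum>k\<le>N. if k = N - j \<and> j \<le> N then cnj (coeff p k) else 0)"
    by (intro sum.cong) auto
  also have "\<dots> = (if j \<le> N then cnj (coeff p (N - j)) else 0)"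
    by (cases "j \<le> N") auto
  finally show ?thesis .
qed

lemma poly_star:
  assumes "degree p \<le> N" "z \<noteq> 0"
  shows "poly (star N p) z = z ^ N * cnj (poly p (1 / cnj z))"
proof -
  have "poly (star N p) z = (\<Sum>k\<le>N. cnj (coeff p k) * z ^ (N - k))"
    by (simp add: star_def poly_sum poly_monom)
  also have "\<dots> = (\<Sum>k\<le>N. z ^ N * cnj (coeff p k * (1 / cnj z) ^ k))"
    using assms(2) by (intro sum.cong) (auto simp: power_diff power_one_over field_simps)
  also have "\<dots> = z ^ N * cnj (poly (\<Sum>k\<le>N. monom (coeff p k) k) (1 / cnj z))"
    by (simp add: sum_distrib_left poly_sum poly_monom)
  finally show ?thesis using assms(1) by (simp add: poly_as_sum_of_monoms')
qed

lemma poly_star_circle: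
  assumes "degree p \<le> N" "cmod z = 1"
  shows "poly (star N p) z = z ^ N * cnj (poly p z)"
proof -
  have "z * cnj z = 1" using assms(2) by (simp add: complex_norm_square[symmetric])
  moreover then have "1 / cnj z = z" by (metis mult_zero_right nonzero_eq_divide_eq zero_neq_one)
  ultimately show ?thesis using poly_star[OF assms(1), of z] by force
qed

text \<open>The reversal is multiplicative because on the circle it is \<open>z \<mapsto> z\<^sup>N cnj (p z)\<close>.\<close>

lemma star_mult:
  assumes "degree p \<le> m" "degree q \<le> n"
  shows "star (m + n) (p * q) = star m p * star n q"
proof (rule poly_eqI_circle)
  fix z :: complex assume z: "cmod z = 1"
  have "degree (p * q) \<le> m + n" using degree_mult_le[of p q] assms by linarith
  then show "poly (star (m + n) (p * q)) z = poly (star m p * star n q) z"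
    using assms z by (simp add: poly_star_circle power_add)
qed

lemma star_eq_0_iff: "degree p \<le> N \<Longrightarrow> star N p = 0 \<longleftrightarrow> p = 0"
proof
  assume "degree p \<le> N" "star N p = 0"
  then have "coeff p k = 0" for k
    using coeff_star[of N p "N - k"] by (cases "k \<le> N") (auto simp: coeff_eq_0)
  then show "p = 0" by (simp add: poly_eq_iff)
qed (simp add: star_def)

lemma order_prod:
  fixes f :: "'b \<Rightarrow> 'a :: idom poly"
  assumes "\<And>x. x \<in> A \<Longrightarrow> f x \<noteq> 0"
  shows "Polynomial.order b (prod f A) = (\<Sum>x\<in>A. Polynomial.order b (f x))"
  using assms
proof (induction A rule: infinite_finite_induct)
  case (insert x A)
  then have "f x * prod f A \<noteq> 0" by (auto simp: prod_zero_iff)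
  then show ?case using insert by (simp add: order_mult)
qed auto

lemma order_pow:
  fixes p :: "'a :: idom poly"
  assumes "p \<noteq> 0"
  shows "Polynomial.order b (p ^ n) = n * Polynomial.order b p"
  using order_prod[of "{..<n}" "\<lambda>_. p" b] assms by simp

text \<open>Reversal reflects the zeros across the circle; the factor \<open>z - a\<close> becomes \<open>1 - cnj a z\<close>, whose
  zero is \<open>b = 1 / cnj a\<close>.\<close>

lemma order_star_nonzero:
  assumes "p \<noteq> 0" "degree p \<le> N" "b \<noteq> 0"
  shows "Polynomial.order b (star N p) = Polynomial.order (1 / cnj b) p"
proof -
  define a where "a = 1 / cnj b"
  define l where "l = Polynomial.order a p"
  have ab: "cnj a * b = 1" "a \<noteq> 0" using assms(3) by (auto simp: a_def)
  obtain u where u: "p = [:- a, 1:] ^ l * u" "\<not> [:- a, 1:] dvd u"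
    using order_decomp[OF assms(1)] unfolding l_def by blast
  have ua: "poly u a \<noteq> 0" using u(2) by (simp add: poly_eq_0_iff_dvd)
  then have u0: "u \<noteq> 0" by auto
  have deg: "degree p = l + degree u"
    using u0 unfolding u(1) by (subst degree_mult_eq) (auto simp: degree_power_eq)
  have d1: "degree ([:- a, 1:] ^ l) \<le> l" by (simp add: degree_power_eq)
  have d2: "degree u \<le> N - l" using deg assms(2) by linarith
  have "star l ([:- a, 1:] ^ l) = [:1, - cnj a:] ^ l"
  proof (rule poly_eqI_circle)
    fix z :: complex assume z: "cmod z = 1"
    then have "z * cnj z = 1" by (simp add: complex_norm_square[symmetric])
    then have "z * cnj (z - a) = 1 - cnj a * z" by (simp add: algebra_simps)
    then show "poly (star l ([:- a, 1:] ^ l)) z = poly ([:1, - cnj a:] ^ l) z"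
      using z d1 by (simp add: poly_star_circle poly_power power_mult_distrib[symmetric] mult.commute)
  qed
  moreover have "[:1, - cnj a:] ^ l = smult ((- cnj a) ^ l) ([:- b, 1:] ^ l)"
  proof -
    have "[:1, - cnj a:] = smult (- cnj a) [:- b, 1:]" using ab by (simp add: mult.commute)
    then show ?thesis by (simp only: smult_power)
  qed
  moreover have "star N p = star l ([:- a, 1:] ^ l) * star (N - l) u"
    using star_mult[OF d1 d2] deg assms(2) u(1) by simp
  ultimately have st: "star N p = smult ((- cnj a) ^ l) ([:- b, 1:] ^ l) * star (N - l) u" by simp
  have "poly (star (N - l) u) b \<noteq> 0"
    using poly_star[OF d2 assms(3)] ua assms(3) by (simp add: a_def)
  moreover have "star N p \<noteq> 0" using assms star_eq_0_iff by simp
  ultimately have "Polynomial.order b (star N p) = l"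
    unfolding st using ab by (subst order_mult) (simp_all add: order_0I order_smult order_power_n_n)
  then show ?thesis by (simp add: l_def a_def)
qed

lemma order_star_zero:
  assumes "p \<noteq> 0" "degree p \<le> N"
  shows "Polynomial.order 0 (star N p) = N - degree p"
proof -
  have "star (N - degree p) 1 = monom 1 (N - degree p)"
    by (rule poly_eqI) (auto simp: coeff_star)
  then have st: "star N p = monom 1 (N - degree p) * star (degree p) p"
    using star_mult[of 1 "N - degree p" p "degree p"] assms(2) by simp
  have "poly (star (degree p) p) 0 \<noteq> 0"
    using assms(1) by (simp add: poly_0_coeff_0 coeff_star)
  moreover have "star N p \<noteq> 0" using assms star_eq_0_iff by simp
  ultimately show ?thesis unfolding st by (subst order_mult) (simp_all add: order_0I)
qed

lemma dvd_if_order_le: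
  fixes R f :: "complex poly"
  assumes "R \<noteq> 0" "f \<noteq> 0" "\<And>b. Polynomial.order b R \<le> Polynomial.order b f"
  shows "R dvd f"
  using assms
proof (induction R arbitrary: f rule: poly_root_order_induct)
  case (no_roots R)
  then have "degree R = 0" using fundamental_theorem_of_algebra[of R] constant_degree by blast
  then obtain c where "R = [:c:]" by (metis degree_eq_zeroE)
  moreover then have "c \<noteq> 0" using no_roots by auto
  ultimately show ?case using const_poly_dvd_iff by (metis dvd_field_iff is_unit_const_poly_iff unit_imp_dvd)
next
  case (root R a n)
  let ?l = "[:- a, 1:] ^ n"
  have R0: "R \<noteq> 0" using root.prems(1) by auto
  have "?l dvd f"
  proof -
    have "n \<le> Polynomial.order a (?l * R)"
      using root.prems(1) by (subst order_mult) (simp_all add: order_power_n_n)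
    then have "n \<le> Polynomial.order a f" using root.prems(3) order_trans by blast
    then show ?thesis by (simp add: order_divides)
  qed
  then obtain g where g: "f = ?l * g" by (elim dvdE)
  have "Polynomial.order b R \<le> Polynomial.order b g" for b
    using root.prems(3)[of b] root.prems(1,2) unfolding g by (simp add: order_mult)
  then have "R dvd g" using root.IH[OF R0] g root.prems(2) by auto
  then show ?case unfolding g by (rule mult_dvd_mono[OF dvd_refl])
qed simp

text \<open>With \<open>b = cis s\<close> and \<open>l\<close> the order of \<open>b\<close>, the nonnegative function \<open>cnj z\<^sup>n P z\<close> at \<open>z = cis t\<close>
  is \<open>sin ((t - s) / 2)\<^sup>l H t\<close> with \<open>H\<close> continuous and \<open>H s \<noteq> 0\<close>. For odd \<open>l\<close> the sine factor
  changes sign at \<open>s\<close>, which forces \<open>H s = 0\<close>.\<close>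

lemma even_order_if_nonneg_on_circle:
  fixes P :: "complex poly"
  assumes "P \<noteq> 0"
    and nonneg: "\<And>z. cmod z = 1 \<Longrightarrow> cnj z ^ n * poly P z \<in> \<real>\<^sub>\<ge>\<^sub>0"
    and b: "cmod b = 1"
  shows "even (Polynomial.order b P)"
proof (rule ccontr)
  define l where "l = Polynomial.order b P"
  assume "odd (Polynomial.order b P)"
  then have odd: "odd l" by (simp add: l_def)
  obtain u where u: "P = [:- b, 1:] ^ l * u" "\<not> [:- b, 1:] dvd u"
    using order_decomp[OF assms(1)] unfolding l_def by blast
  have ub: "poly u b \<noteq> 0" using u(2) by (simp add: poly_eq_0_iff_dvd)
  obtain s where s: "b = cis s" using cis_Arg_unit[OF b] by metis
  define H where "H t = cis (- (real n * t)) * (2 * \<i> * cis ((t + s) / 2)) ^ l * poly u (cis t)" for t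
  have dif: "cis t - cis s = of_real (sin ((t - s) / 2)) * (2 * \<i> * cis ((t + s) / 2))" for t
  proof -
    have "cis t = cis ((t + s) / 2) * cis ((t - s) / 2)" "cis s = cis ((t + s) / 2) * cis (- ((t - s) / 2))"
      by (simp_all add: cis_mult add_divide_distrib[symmetric] diff_divide_distrib[symmetric])
    moreover have "cis v - cis (- v) = of_real (sin v) * (2 * \<i>)" for v
      by (simp add: complex_eq_iff)
    ultimately have "cis t - cis s = cis ((t + s) / 2) * (of_real (sin ((t - s) / 2)) * (2 * \<i>))"
      by (simp only: right_diff_distrib[symmetric])
    then show ?thesis by (simp only: mult_ac)
  qed
  have eq: "cnj (cis t) ^ n * poly P (cis t) = of_real (sin ((t - s) / 2) ^ l) * H t" for t
  proof -
    have "poly P (cis t) = (cis t - cis s) ^ l * poly u (cis t)"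
      by (simp add: u(1) s poly_power)
    moreover have "cnj (cis t) ^ n = cis (- (real n * t))"
      by (simp add: cis_cnj Complex.DeMoivre)
    ultimately show ?thesis by (simp only: H_def dif power_mult_distrib of_real_power mult_ac)
  qed
  have H: "of_real (sin ((t - s) / 2) ^ l) * H t \<in> \<real>\<^sub>\<ge>\<^sub>0" for t
    unfolding eq[symmetric] by (rule nonneg) simp
  have "continuous_on UNIV H" unfolding H_def by (intro continuous_intros) simp_all
  then have cont: "isCont H s" by (simp add: continuous_on_eq_continuous_at)
  have cancel: "complex_of_real (c / x) * (of_real x * w) = of_real c * w" if "x \<noteq> 0" for c x w
    using that by simp
  have "H s \<in> \<real>\<^sub>\<ge>\<^sub>0"
  proof (rule Lim_in_closed_set)
    show "(H \<longlongrightarrow> H s) (at_right s)" using cont by (simp add: continuous_at_imp_continuous_at_within continuous_within[symmetric])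
    show "eventually (\<lambda>t. H t \<in> \<real>\<^sub>\<ge>\<^sub>0) (at_right s)"
    proof (rule eventually_at_rightI)
      show "s < s + pi" by simp
      fix t assume "t \<in> {s<..<s + pi}"
      then have "sin ((t - s) / 2) > 0" by (intro sin_gt_zero) auto
      then have pos: "sin ((t - s) / 2) ^ l > 0" by simp
      have nz: "sin ((t - s) / 2) ^ l \<noteq> 0" using pos by linarith
      have "of_real (1 / sin ((t - s) / 2) ^ l) * (of_real (sin ((t - s) / 2) ^ l) * H t) \<in> \<real>\<^sub>\<ge>\<^sub>0"
        by (rule nonneg_Reals_mult_I[OF _ H])
          (simp only: nonneg_Reals_of_real_iff, rule divide_nonneg_pos[OF _ pos], simp)
      moreover have "of_real (1 / sin ((t - s) / 2) ^ l) * (of_real (sin ((t - s) / 2) ^ l) * H t) = H t"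
        unfolding cancel[OF nz] by simp
      ultimately show "H t \<in> \<real>\<^sub>\<ge>\<^sub>0" by (simp only:)
    qed
  qed simp_all
  moreover have "- H s \<in> \<real>\<^sub>\<ge>\<^sub>0"
  proof (rule Lim_in_closed_set)
    show "((\<lambda>t. - H t) \<longlongrightarrow> - H s) (at_left s)" using cont
      by (intro tendsto_intros) (simp add: continuous_at_imp_continuous_at_within continuous_within[symmetric])
    show "eventually (\<lambda>t. - H t \<in> \<real>\<^sub>\<ge>\<^sub>0) (at_left s)"
    proof (rule eventually_at_leftI)
      show "s - pi < s" by simp
      fix t assume "t \<in> {s - pi<..<s}"
      then have "sin ((s - t) / 2) > 0" by (intro sin_gt_zero) auto
      moreover have "sin ((t - s) / 2) = - sin ((s - t) / 2)" by (metis minus_diff_eq minus_divide_left sin_minus)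
      ultimately have pos: "sin ((t - s) / 2) ^ l < 0" using odd by (simp add: power_less_zero_eq)
      have nz: "sin ((t - s) / 2) ^ l \<noteq> 0" using pos by linarith
      have "of_real (- 1 / sin ((t - s) / 2) ^ l) * (of_real (sin ((t - s) / 2) ^ l) * H t) \<in> \<real>\<^sub>\<ge>\<^sub>0"
        by (rule nonneg_Reals_mult_I[OF _ H])
          (simp only: nonneg_Reals_of_real_iff, rule divide_nonpos_neg[OF _ pos], simp)
      moreover have "of_real (- 1 / sin ((t - s) / 2) ^ l) * (of_real (sin ((t - s) / 2) ^ l) * H t) = - H t"
        unfolding cancel[OF nz] by simp
      ultimately show "- H t \<in> \<real>\<^sub>\<ge>\<^sub>0" by (simp only:)
    qed
  qed simp_all
  ultimately have "H s = 0"
    by (metis complex_nonneg_Reals_iff complex_eq_iff antisym neg_0_le_iff_le uminus_complex.sel(1) zero_complex.sel)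
  then show False using ub by (simp add: H_def s)
qed

section \<open>Factorisation of the polynomials aligned with \<open>p\<close>\<close>

text \<open>The common shape of \<open>G_poly\<close> and \<open>G0_poly\<close>: for each \<open>a \<in> A\<close> the zero \<open>a\<close> and its mirror image
  \<open>1 / cnj a\<close>, both with multiplicity \<open>m a\<close>. For \<open>a = 0\<close> the second factor is 1, and for \<open>a\<close> on the
  circle both zeros coincide.\<close>

definition mirror_prod :: "complex set \<Rightarrow> (complex \<Rightarrow> nat) \<Rightarrow> complex poly" where
  "mirror_prod A m = (\<Prod>a\<in>A. [:- a, 1:] ^ m a * [:1, - cnj a:] ^ m a)"

lemma mirror_prod_nonzero: "mirror_prod A m \<noteq> 0"
proof (cases "finite A")
  case True
  then show ?thesis by (simp add: mirror_prod_def prod_zero_iff)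
qed (simp add: mirror_prod_def)

lemma order_linear_reversed: "Polynomial.order b [:1, - c:] = (if c * b = 1 then 1 else 0)" for b c :: "'a :: field"
proof (cases "c * b = 1")
  case True
  then have "[:1, - c:] = smult (- c) [:- b, 1:]" "c \<noteq> 0" by auto
  then show ?thesis using True order_power_n_n[of b 1] by (simp add: order_smult del: smult_pCons)
next
  case False
  then show ?thesis by (simp add: order_0I mult.commute)
qed

lemma order_linear: "Polynomial.order b [:- a, 1:] = (if b = a then 1 else 0)" for a b :: "'a :: idom"
  using order_power_n_n[of a 1] by (auto simp: order_0I)

lemma order_mirror_prod:
  "Polynomial.order b (mirror_prod A m) =
    (\<Sum>a\<in>A. (if b = a then m a else 0) + (if cnj a * b = 1 then m a else 0))"
  unfolding mirror_prod_def
  by (subst order_prod, simp, rule sum.cong[OF refl])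
    (auto simp: order_mult order_pow order_linear order_linear_reversed)

text \<open>The degree falls short of twice the total multiplicity only because \<open>a = 0\<close> has no mirror image.\<close>

lemma degree_mirror_prod:
  "degree (mirror_prod A m) + (\<Sum>a\<in>A. if a = 0 then m a else 0) = 2 * (\<Sum>a\<in>A. m a)"
proof -
  have "degree (mirror_prod A m) = (\<Sum>a\<in>A. if a = 0 then m a else 2 * m a)"
    unfolding mirror_prod_def
    by (subst degree_prod_sum_eq, simp, rule sum.cong[OF refl]) (auto simp: degree_mult_eq degree_power_eq)
  then show ?thesis
    unfolding sum_distrib_left by (simp only: sum.distrib[symmetric]) (intro sum.cong, auto)
qed

text \<open>On the circle \<open>(z - a) (1 - cnj a z) = z \<bar>z - a\<bar>\<^sup>2\<close>.\<close>

lemma poly_mirror_prod_circle: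
  assumes z: "cmod z = 1"
  shows "\<exists>r\<ge>0. poly (mirror_prod A m) z = z ^ (\<Sum>a\<in>A. m a) * of_real r"
proof -
  have "poly ([:- a, 1:] ^ k * [:1, - cnj a:] ^ k) z = z ^ k * of_real ((cmod (z - a))\<^sup>2 ^ k)" for a k
  proof -
    have "z * cnj z = 1" using z by (simp add: complex_norm_square[symmetric])
    then have "(z - a) * (1 - cnj a * z) = (z - a) * (z * (cnj z - cnj a))" by (simp add: algebra_simps)
    also have "\<dots> = z * of_real ((cmod (z - a))\<^sup>2)" unfolding complex_norm_square by simp
    finally have "((z - a) * (1 - cnj a * z)) ^ k = (z * of_real ((cmod (z - a))\<^sup>2)) ^ k" by (rule arg_cong)
    moreover have "poly ([:- a, 1:] ^ k * [:1, - cnj a:] ^ k) z = ((z - a) * (1 - cnj a * z)) ^ k"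
      by (simp add: poly_power power_mult_distrib mult.commute)
    ultimately show ?thesis by (simp only: power_mult_distrib of_real_power)
  qed
  then have "poly (mirror_prod A m) z = (\<Prod>a\<in>A. z ^ m a * of_real ((cmod (z - a))\<^sup>2 ^ m a))"
    by (simp only: mirror_prod_def poly_prod)
  also have "\<dots> = z ^ (\<Sum>a\<in>A. m a) * of_real (\<Prod>a\<in>A. (cmod (z - a))\<^sup>2 ^ m a)"
    by (simp add: prod.distrib power_sum)
  finally show ?thesis by (intro exI[of _ "\<Prod>a\<in>A. (cmod (z - a))\<^sup>2 ^ m a"]) (auto intro: prod_nonneg)
qed

text \<open>The divisor \<open>G~ = G G\<^sub>0\<close> of \<open>p\<close> whose cofactor is \<open>R_tilde\<close>.\<close>

definition G_tilde :: "nat \<Rightarrow> complex poly \<Rightarrow> complex poly" where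
  "G_tilde N p = G_poly N p * G0_poly p"

lemma G_poly_eq: "G_poly N p = mirror_prod (common_zeros N p) (common_mult N p)"
  by (simp add: G_poly_def mirror_prod_def)

lemma G0_poly_eq: "G0_poly p = mirror_prod (circle_zeros p) (half_mult p)"
  by (simp add: G0_poly_def mirror_prod_def)

lemma G_tilde_nonzero: "G_tilde N p \<noteq> 0"
  by (simp add: G_tilde_def G_poly_eq G0_poly_eq mirror_prod_nonzero)

lemma finite_common_zeros: "p \<noteq> 0 \<Longrightarrow> finite (common_zeros N p)"
  unfolding common_zeros_def by (rule finite_subset[OF _ poly_roots_finite]) auto

lemma finite_circle_zeros: "p \<noteq> 0 \<Longrightarrow> finite (circle_zeros p)"
  unfolding circle_zeros_def by (rule finite_subset[OF _ poly_roots_finite]) auto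

lemma cnj_mult_eq_1_iff:
  fixes a b :: complex
  assumes "b \<noteq> 0"
  shows "cnj a * b = 1 \<longleftrightarrow> a = 1 / cnj b"
proof
  assume "cnj a * b = 1"
  then have "cnj (cnj a * b) = 1" by simp
  then show "a = 1 / cnj b" using assms by (simp add: field_simps)
qed (use assms in simp)

lemma inverse_cnj_circle: "cmod b = 1 \<Longrightarrow> 1 / cnj b = b"
  by (metis cnj_mult_eq_1_iff complex_norm_square mult.commute norm_zero of_real_1 one_power2 zero_neq_one)

lemma common_mult_if: "p \<noteq> 0 \<Longrightarrow> degree p \<le> N \<Longrightarrow> cmod a < 1 \<Longrightarrow>
  (if a \<in> common_zeros N p then common_mult N p a else 0) =
    min (Polynomial.order a p) (Polynomial.order a (star N p))"
  using star_eq_0_iff[of p N] by (auto simp: common_zeros_def common_mult_def order_0I min_def)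

text \<open>Outside the closed disc the order is inherited from the mirror point, where the orders of \<open>p\<close> and
  \<open>star N p\<close> are interchanged.\<close>

lemma order_G_tilde_off_circle:
  assumes p: "p \<noteq> 0" "degree p \<le> N" and b: "cmod b \<noteq> 1"
  shows "Polynomial.order b (G_tilde N p) = min (Polynomial.order b p) (Polynomial.order b (star N p))"
proof -
  let ?A = "common_zeros N p" and ?m = "common_mult N p"
  have fin: "finite ?A" by (rule finite_common_zeros[OF p(1)])
  have norm: "cmod a * cmod b = 1" if "cnj a * b = 1" for a
    using arg_cong[OF that, of cmod] by (simp add: norm_mult)
  have "Polynomial.order b (G0_poly p) = 0"
    unfolding G0_poly_eq order_mirror_prod using b norm by (force simp: circle_zeros_def intro: sum.neutral)
  then have 1: "Polynomial.order b (G_tilde N p) = Polynomial.order b (G_poly N p)"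
    using G_tilde_nonzero[of N p] by (simp add: G_tilde_def order_mult)
  show ?thesis
  proof (cases "cmod b < 1")
    case True
    have "cnj a * b \<noteq> 1" if "a \<in> ?A" for a
    proof
      assume "cnj a * b = 1"
      moreover have "cmod a < 1" using that by (simp add: common_zeros_def)
      moreover have "cmod a * cmod b < 1 * 1" using calculation(2) True by (intro mult_strict_mono') auto
      ultimately show False using norm by auto
    qed
    then have "Polynomial.order b (G_poly N p) = (\<Sum>a\<in>?A. if b = a then ?m a else 0)"
      unfolding G_poly_eq order_mirror_prod by (intro sum.cong) auto
    also have "\<dots> = (if b \<in> ?A then ?m b else 0)" using fin by simp
    finally show ?thesis using 1 common_mult_if[OF p True] by simp
  next
    case False
    then have b1: "cmod b > 1" and b0: "b \<noteq> 0" using b by auto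
    define a0 where "a0 = 1 / cnj b"
    have a0: "cmod a0 < 1" "a0 \<noteq> 0" "1 / cnj a0 = b"
      using b1 b0 by (auto simp: a0_def norm_divide)
    have "b \<noteq> a" if "a \<in> ?A" for a using that b1 by (auto simp: common_zeros_def)
    then have "Polynomial.order b (G_poly N p) = (\<Sum>a\<in>?A. if a = a0 then ?m a else 0)"
      unfolding G_poly_eq order_mirror_prod a0_def by (intro sum.cong) (auto simp: cnj_mult_eq_1_iff[OF b0])
    also have "\<dots> = (if a0 \<in> ?A then ?m a0 else 0)" using fin by simp
    also have "\<dots> = min (Polynomial.order a0 p) (Polynomial.order a0 (star N p))"
      by (rule common_mult_if[OF p a0(1)])
    also have "Polynomial.order a0 (star N p) = Polynomial.order b p"
      using order_star_nonzero[OF p a0(2)] a0(3) by simp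
    also have "Polynomial.order a0 p = Polynomial.order b (star N p)"
      using order_star_nonzero[OF p b0] a0_def by simp
    finally show ?thesis using 1 by simp
  qed
qed

lemma order_G_tilde_on_circle:
  assumes p: "p \<noteq> 0" "degree p \<le> N" and b: "cmod b = 1"
  shows "Polynomial.order b (G_tilde N p) = 2 * (Polynomial.order b p div 2)"
proof -
  let ?Z = "circle_zeros p"
  have b0: "b \<noteq> 0" using b by auto
  have fin: "finite ?Z" by (rule finite_circle_zeros[OF p(1)])
  have "Polynomial.order b (G_poly N p) = 0"
    unfolding G_poly_eq order_mirror_prod cnj_mult_eq_1_iff[OF b0] inverse_cnj_circle[OF b]
    using b by (intro sum.neutral) (auto simp: common_zeros_def)
  then have "Polynomial.order b (G_tilde N p) = Polynomial.order b (G0_poly p)"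
    using G_tilde_nonzero[of N p] by (simp add: G_tilde_def order_mult)
  also have "\<dots> = (\<Sum>a\<in>?Z. if a = b then 2 * half_mult p a else 0)"
    unfolding G0_poly_eq order_mirror_prod cnj_mult_eq_1_iff[OF b0] inverse_cnj_circle[OF b]
    by (intro sum.cong) auto
  also have "\<dots> = 2 * (Polynomial.order b p div 2)"
    using fin b by (auto simp: circle_zeros_def half_mult_def order_0I)
  finally show ?thesis .
qed

lemma degree_G_tilde:
  assumes p: "p \<noteq> 0" "degree p \<le> N"
  shows "degree (G_tilde N p) + min (Polynomial.order 0 p) (N - degree p) = 2 * m_tilde N p"
proof -
  have "(\<Sum>a\<in>common_zeros N p. if a = 0 then common_mult N p a else 0) = min (Polynomial.order 0 p) (N - degree p)"
    using common_mult_if[OF p, of 0] finite_common_zeros[OF p(1), of N] order_star_zero[OF p] by simp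
  moreover have "(\<Sum>a\<in>circle_zeros p. if a = 0 then half_mult p a else 0) = 0"
    by (intro sum.neutral) (auto simp: circle_zeros_def)
  moreover have "degree (G_tilde N p) = degree (G_poly N p) + degree (G0_poly p)"
    using G_tilde_nonzero[of N p] unfolding G_tilde_def by (intro degree_mult_eq) auto
  ultimately show ?thesis
    using degree_mirror_prod[of "common_zeros N p" "common_mult N p"]
      degree_mirror_prod[of "circle_zeros p" "half_mult p"]
    by (simp add: m_tilde_def G_poly_eq G0_poly_eq)
qed

lemma poly_G_tilde_circle:
  assumes "cmod z = 1"
  shows "\<exists>r\<ge>0. poly (G_tilde N p) z = z ^ m_tilde N p * of_real r"
proof -
  obtain r s where "r \<ge> 0" "poly (G_poly N p) z = z ^ (\<Sum>a\<in>common_zeros N p. common_mult N p a) * of_real r"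
    "s \<ge> 0" "poly (G0_poly p) z = z ^ (\<Sum>a\<in>circle_zeros p. half_mult p a) * of_real s"
    unfolding G_poly_eq G0_poly_eq using poly_mirror_prod_circle[OF assms] by metis
  then show ?thesis
    by (intro exI[of _ "r * s"]) (simp add: G_tilde_def m_tilde_def power_add)
qed

lemma p_eq_R_tilde_mult_G_tilde:
  assumes p: "p \<noteq> 0" "degree p \<le> N"
  shows "p = R_tilde N p * G_tilde N p"
proof -
  have "Polynomial.order b (G_tilde N p) \<le> Polynomial.order b p" for b
    by (cases "cmod b = 1") (simp_all add: order_G_tilde_off_circle[OF p] order_G_tilde_on_circle[OF p])
  then have "G_tilde N p dvd p" by (rule dvd_if_order_le[OF G_tilde_nonzero p(1)])
  then show ?thesis by (simp add: R_tilde_def G_tilde_def)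
qed

lemma degree_R_tilde:
  assumes p: "p \<noteq> 0" "degree p \<le> N"
  shows "degree (R_tilde N p) + 2 * m_tilde N p \<le> N"
proof -
  have "R_tilde N p \<noteq> 0" using p_eq_R_tilde_mult_G_tilde[OF p] p(1) by auto
  then have "degree p = degree (R_tilde N p) + degree (G_tilde N p)"
    using degree_mult_eq[OF _ G_tilde_nonzero, of "R_tilde N p" N p] p_eq_R_tilde_mult_G_tilde[OF p] by simp
  then show ?thesis using degree_G_tilde[OF p] p(2) by linarith
qed

text \<open>The zeros of \<open>p\<close> on the circle are isolated, so a closed condition extends to them by continuity.\<close>

lemma nonneg_Reals_if_generic:
  assumes p: "p \<noteq> 0" and cont: "continuous_on UNIV h"
    and gen: "\<And>z. cmod z = 1 \<Longrightarrow> poly p z \<noteq> 0 \<Longrightarrow> h z \<in> \<real>\<^sub>\<ge>\<^sub>0"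
    and z: "cmod z = 1"
  shows "h z \<in> (\<real>\<^sub>\<ge>\<^sub>0 :: complex set)"
proof -
  define s where "s = Arg z"
  define Z where "Z = {t \<in> {-pi..pi}. poly p (cis t) = 0}"
  have Z: "finite Z" unfolding Z_def by (rule finite_zeros_cis[OF p])
  have s: "cis s = z" "-pi < s" "s \<le> pi" using cis_Arg_unit[OF z] Arg_bounded[of z] by (auto simp: s_def)
  have "continuous_on UNIV (\<lambda>t. h (cis t))"
    by (rule continuous_on_compose2[OF cont continuous_on_cis]) (auto intro: continuous_intros)
  then have "isCont (\<lambda>t. h (cis t)) s" by (simp add: continuous_on_eq_continuous_at)
  then have "((\<lambda>t. h (cis t)) \<longlongrightarrow> h (cis s)) (at_left s)"
    unfolding isCont_def by (rule tendsto_within_subset) simp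
  moreover have "eventually (\<lambda>t. h (cis t) \<in> \<real>\<^sub>\<ge>\<^sub>0) (at_left s)"
  proof -
    have "open (- (Z - {s}))" using Z by (intro open_Compl finite_imp_closed) simp
    then have "eventually (\<lambda>t. t \<in> - (Z - {s})) (nhds s)"
      by (rule eventually_nhds_in_open) simp
    then have "eventually (\<lambda>t. t \<in> - (Z - {s})) (at_left s)"
      by (auto simp: eventually_at_filter elim: eventually_mono)
    moreover have "eventually (\<lambda>t. t \<in> {-pi<..<s}) (at_left s)"
      by (rule eventually_at_leftI[OF _ s(2)])
    ultimately show ?thesis
      by eventually_elim (use s(3) in \<open>auto simp: Z_def intro!: gen\<close>)
  qed
  ultimately have "h (cis s) \<in> \<real>\<^sub>\<ge>\<^sub>0"
    by (intro Lim_in_closed_set[OF closed_nonneg_Reals_complex]) auto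
  then show ?thesis by (simp add: s)
qed

lemma aligned_iff:
  assumes p: "p \<noteq> 0" "degree p \<le> N"
  shows "aligned (R_tilde N p * q) p \<longleftrightarrow>
    (\<forall>z. cmod z = 1 \<longrightarrow> cnj z ^ m_tilde N p * poly q z \<in> \<real>\<^sub>\<ge>\<^sub>0)"
proof -
  let ?R = "R_tilde N p" and ?m = "m_tilde N p"
  \<comment> \<open>Here \<open>r = \<bar>R z\<bar>\<^sup>2 \<bar>G~ z\<bar>\<close>, by \<open>p = R G~\<close>.\<close>
  have key: "\<exists>r\<ge>0. (poly p z \<noteq> 0 \<longrightarrow> r > 0) \<and>
      poly (?R * q) z * cnj (poly p z) = of_real r * (cnj z ^ ?m * poly q z)" if zc: "cmod z = 1" for z
  proof -
    obtain r where r: "r \<ge> 0" "poly (G_tilde N p) z = z ^ ?m * complex_of_real r"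
      using poly_G_tilde_circle[OF zc] by blast
    have pz: "poly p z = poly ?R z * (z ^ ?m * of_real r)"
      using p_eq_R_tilde_mult_G_tilde[OF p] r(2) by (metis poly_mult)
    have "poly (?R * q) z * cnj (poly p z) = (poly ?R z * cnj (poly ?R z)) * of_real r * (cnj z ^ ?m * poly q z)"
      by (simp add: pz)
    also have "\<dots> = of_real ((cmod (poly ?R z))\<^sup>2 * r) * (cnj z ^ ?m * poly q z)"
      unfolding of_real_mult complex_norm_square by (simp only: mult_ac)
    finally show ?thesis using r(1)
      by (intro exI[of _ "(cmod (poly ?R z))\<^sup>2 * r"]) (auto simp: pz zero_less_mult_iff)
  qed
  show ?thesis
  proof
    assume al: "aligned (?R * q) p"
    show "\<forall>z. cmod z = 1 \<longrightarrow> cnj z ^ ?m * poly q z \<in> \<real>\<^sub>\<ge>\<^sub>0"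
    proof (intro allI impI)
      fix z assume "cmod z = 1"
      then show "cnj z ^ ?m * poly q z \<in> \<real>\<^sub>\<ge>\<^sub>0"
      proof (rule nonneg_Reals_if_generic[OF p(1), rotated 2])
        show "continuous_on UNIV (\<lambda>z. cnj z ^ ?m * poly q z)" by (intro continuous_intros)
        fix w assume w: "cmod w = 1" "poly p w \<noteq> 0"
        then obtain r where r: "r > 0" "poly (?R * q) w * cnj (poly p w) = of_real r * (cnj w ^ ?m * poly q w)"
          using key by blast
        have "of_real (1 / r) * (poly (?R * q) w * cnj (poly p w)) \<in> \<real>\<^sub>\<ge>\<^sub>0"
          using al w(1) r(1) unfolding aligned_def
          by (intro nonneg_Reals_mult_I[of "of_real (1 / r)"]) (simp_all only: nonneg_Reals_of_real_iff, simp)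
        moreover have "of_real (1 / r) * (of_real r * (cnj w ^ ?m * poly q w)) = cnj w ^ ?m * poly q w"
          using r(1) by simp
        ultimately show "cnj w ^ ?m * poly q w \<in> \<real>\<^sub>\<ge>\<^sub>0" unfolding r(2) by (simp only:)
      qed
    qed
  next
    assume nn: "\<forall>z. cmod z = 1 \<longrightarrow> cnj z ^ ?m * poly q z \<in> \<real>\<^sub>\<ge>\<^sub>0"
    show "aligned (?R * q) p" unfolding aligned_def
    proof (intro allI impI)
      fix z assume z: "cmod z = 1"
      then obtain r where r: "r \<ge> 0" "poly (?R * q) z * cnj (poly p z) = of_real r * (cnj z ^ ?m * poly q z)"
        using key by blast
      show "poly (?R * q) z * cnj (poly p z) \<in> \<real>\<^sub>\<ge>\<^sub>0"
        unfolding r(2) using nn z r(1) by (intro nonneg_Reals_mult_I[of "of_real r"]) (simp_all only: nonneg_Reals_of_real_iff)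
    qed
  qed
qed

text \<open>\<open>R\<close> divides \<open>f\<close> because no zero of \<open>R\<close> has larger order in \<open>R\<close> than in \<open>f\<close>. The bound on
  \<open>degree q\<close> does not follow from \<open>degree f \<le> N\<close> alone, since \<open>R\<close> may have degree less than
  \<open>N - 2 m\<close>; it uses the orders at 0.\<close>

lemma aligned_factor:
  assumes p: "p \<noteq> 0" "degree p \<le> N" and f: "degree f \<le> N" and al: "aligned f p"
  obtains q where "f = R_tilde N p * q" "degree q \<le> 2 * m_tilde N p"
proof (cases "f = 0")
  case True
  then show ?thesis using that[of 0] by simp
next
  case False
  let ?R = "R_tilde N p" and ?o = "\<lambda>b p. Polynomial.order b p"
  have pR: "p = ?R * G_tilde N p" by (rule p_eq_R_tilde_mult_G_tilde[OF p])
  have R0: "?R \<noteq> 0" using pR p(1) by auto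
  have oR: "?o b p = ?o b ?R + ?o b (G_tilde N p)" for b
    using order_mult[of ?R "G_tilde N p"] pR p(1) by metis
  have ps0: "star N p \<noteq> 0" using star_eq_0_iff[OF p(2)] p(1) by simp
  have fs0: "star N f \<noteq> 0" using star_eq_0_iff[OF f] False by simp
  \<comment> \<open>On the circle this identity says that \<open>f \<cdot> cnj p\<close> is real.\<close>
  have "f * star N p = star N f * p"
  proof (rule poly_eqI_circle)
    fix z :: complex assume z: "cmod z = 1"
    then have "poly f z * cnj (poly p z) \<in> \<real>\<^sub>\<ge>\<^sub>0" using al by (simp add: aligned_def)
    then have "cnj (poly f z * cnj (poly p z)) = poly f z * cnj (poly p z)"
      by (metis nonneg_Reals_cases complex_cnj_complex_of_real)
    then show "poly (f * star N p) z = poly (star N f * p) z"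
      using z f p(2) by (simp add: poly_star_circle)
  qed
  then have ord: "?o b f + ?o b (star N p) = ?o b (star N f) + ?o b p" for b
    using False ps0 fs0 p(1) order_mult[of f "star N p" b] order_mult[of "star N f" p b] by simp
  have "?o b ?R \<le> ?o b f" for b
  proof (cases "cmod b = 1")
    case False
    then show ?thesis using ord[of b] oR[of b] order_G_tilde_off_circle[OF p False] by linarith
  next
    case True
    then have b0: "b \<noteq> 0" by auto
    \<comment> \<open>At \<open>b\<close> the order of \<open>R\<close> is the order of \<open>p\<close> modulo 2, and the orders of \<open>f\<close> and \<open>p\<close>
      have the same parity.\<close>
    have "even (?o b (f * star N p))"
    proof (rule even_order_if_nonneg_on_circle[OF _ _ True])
      fix z :: complex assume z: "cmod z = 1"
      then have "cnj z ^ N * z ^ N = 1"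
        by (metis complex_norm_square mult.commute of_real_1 one_power2 power_mult_distrib power_one)
      then have "cnj z ^ N * poly (f * star N p) z = poly f z * cnj (poly p z)"
        using z p(2) by (simp add: poly_star_circle)
      then show "cnj z ^ N * poly (f * star N p) z \<in> \<real>\<^sub>\<ge>\<^sub>0" using al z by (simp only: aligned_def)
    qed (use False ps0 in simp)
    then have "even (?o b f + ?o b p)"
      using False ps0 order_star_nonzero[OF p b0] inverse_cnj_circle[OF True] by (simp add: order_mult)
    then show ?thesis using oR[of b] order_G_tilde_on_circle[OF p True] by presburger
  qed
  then have "?R dvd f" by (rule dvd_if_order_le[OF R0 False])
  then obtain q where q: "f = ?R * q" by (elim dvdE)
  have "q \<noteq> 0" using q False by auto
  have dp: "degree p = degree ?R + degree (G_tilde N p)"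
    using degree_mult_eq[OF R0 G_tilde_nonzero] pR by metis
  have df: "degree f = degree ?R + degree q"
    unfolding q by (rule degree_mult_eq[OF R0 \<open>q \<noteq> 0\<close>])
  have "?o 0 f + (N - degree p) = (N - degree f) + ?o 0 p"
    using ord[of 0] order_star_zero[OF p] order_star_zero[OF False f] by simp
  then have "degree q \<le> 2 * m_tilde N p"
    using degree_G_tilde[OF p] dp df f p(2) by linarith
  with q show ?thesis by (rule that)
qed

section \<open>Plus-vectors and plus-dimension\<close>

text \<open>The trigonometric polynomial of a vector, multiplied by \<open>z\<^sup>d\<close>: the polynomial
  \<open>\<alpha>\<^sub>0 z\<^sup>d + \<Sum>k. (c\<^sub>k z\<^bsup>d + k\<^esup> + cnj c\<^sub>k z\<^bsup>d - k\<^esup>)\<close> with \<open>c\<^sub>k = (\<alpha>\<^sub>k + \<i> \<beta>\<^sub>k) / 2\<close>.\<close>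

definition plus_poly :: "nat \<Rightarrow> real Matrix.vec \<Rightarrow> complex poly" where
  "plus_poly d v = monom (of_real (vec_index v 0)) d +
     (\<Sum>k=1..d. monom (Complex (vec_index v k / 2) (vec_index v (d + k) / 2)) (d + k)
             + monom (Complex (vec_index v k / 2) (- vec_index v (d + k) / 2)) (d - k))"

lemma coeff_plus_poly:
  "coeff (plus_poly d v) j =
    (if j = d then of_real (vec_index v 0)
     else if d < j \<and> j \<le> 2 * d then Complex (vec_index v (j - d) / 2) (vec_index v j / 2)
     else if j < d then Complex (vec_index v (d - j) / 2) (- vec_index v (2 * d - j) / 2)
     else 0)"
proof -
  have "coeff (plus_poly d v) j = (if j = d then of_real (vec_index v 0) else 0)
      + (\<Sum>k=1..d. if k = j - d then if d < j then Complex (vec_index v k / 2) (vec_index v (d + k) / 2) else 0 else 0)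
      + (\<Sum>k=1..d. if k = d - j then if j < d then Complex (vec_index v k / 2) (- vec_index v (d + k) / 2) else 0 else 0)"
    unfolding plus_poly_def coeff_add coeff_sum sum.distrib add.assoc
    by (intro arg_cong2[where f = "(+)"] sum.cong) (auto simp: coeff_monom)
  also have "\<dots> = (if j = d then of_real (vec_index v 0) else 0)
      + (if j - d \<in> {1..d} then if d < j then Complex (vec_index v (j - d) / 2) (vec_index v (d + (j - d)) / 2) else 0 else 0)
      + (if d - j \<in> {1..d} then if j < d then Complex (vec_index v (d - j) / 2) (- vec_index v (d + (d - j)) / 2) else 0 else 0)"
    by (simp only: sum.delta finite_atLeastAtMost)
  also have "\<dots> = (if j = d then of_real (vec_index v 0)
     else if d < j \<and> j \<le> 2 * d then Complex (vec_index v (j - d) / 2) (vec_index v j / 2)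
     else if j < d then Complex (vec_index v (d - j) / 2) (- vec_index v (2 * d - j) / 2)
     else 0)"
    by (auto simp: mult_2)
  finally show ?thesis .
qed

lemma degree_plus_poly: "degree (plus_poly d v) \<le> 2 * d"
  by (rule degree_le) (simp add: coeff_plus_poly)

lemma poly_plus_poly_cis:
  "cnj (cis t) ^ d * poly (plus_poly d v) (cis t) =
    of_real (vec_index v 0 + (\<Sum>k=1..d. vec_index v k * cos (real k * t) - vec_index v (d + k) * sin (real k * t)))"
proof -
  have pw: "cis t ^ n = cis (real n * t)" "cnj (cis t) ^ n = cis (- (real n * t))" for n
    by (simp_all add: cis_cnj Complex.DeMoivre)
  have *: "cis (- (real d * t)) * (Complex (a / 2) (b / 2) * cis t ^ (d + k) + Complex (a / 2) (- b / 2) * cis t ^ (d - k))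
      = of_real (a * cos (real k * t) - b * sin (real k * t))" if "k \<in> {1..d}" for a b k
  proof -
    have "cis (- (real d * t)) * cis t ^ (d + k) = cis (real k * t)"
      by (simp add: pw cis_mult algebra_simps)
    moreover have "cis (- (real d * t)) * cis t ^ (d - k) = cis (- (real k * t))"
      using that by (simp add: pw cis_mult of_nat_diff algebra_simps)
    ultimately have "cis (- (real d * t)) * (Complex (a / 2) (b / 2) * cis t ^ (d + k) + Complex (a / 2) (- b / 2) * cis t ^ (d - k))
        = Complex (a / 2) (b / 2) * cis (real k * t) + Complex (a / 2) (- b / 2) * cis (- (real k * t))"
      by (simp only: distrib_left mult.left_commute[of "cis (- (real d * t))"])
    also have "\<dots> = of_real (a * cos (real k * t) - b * sin (real k * t))"
      by (simp add: complex_eq_iff field_simps)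
    finally show ?thesis .
  qed
  have "cnj (cis t) ^ d * poly (plus_poly d v) (cis t) =
      cis (- (real d * t)) * (of_real (vec_index v 0) * cis t ^ d) +
      (\<Sum>k=1..d. cis (- (real d * t)) * (Complex (vec_index v k / 2) (vec_index v (d + k) / 2) * cis t ^ (d + k)
             + Complex (vec_index v k / 2) (- vec_index v (d + k) / 2) * cis t ^ (d - k)))"
    by (simp only: plus_poly_def pw(2) poly_add poly_sum poly_monom distrib_left sum_distrib_left)
  also have "(\<Sum>k=1..d. cis (- (real d * t)) * (Complex (vec_index v k / 2) (vec_index v (d + k) / 2) * cis t ^ (d + k)
             + Complex (vec_index v k / 2) (- vec_index v (d + k) / 2) * cis t ^ (d - k))) =
      (\<Sum>k=1..d. of_real (vec_index v k * cos (real k * t) - vec_index v (d + k) * sin (real k * t)))"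
    by (rule sum.cong[OF refl *])
  also have "cis (- (real d * t)) * (of_real (vec_index v 0) * cis t ^ d) = of_real (vec_index v 0)"
    by (simp add: pw cis_mult mult.left_commute)
  finally show ?thesis by simp
qed

lemma plus_vector_iff:
  assumes "v \<in> carrier_vec (2 * d + 1)"
  shows "plus_vector d v \<longleftrightarrow> (\<forall>z. cmod z = 1 \<longrightarrow> cnj z ^ d * poly (plus_poly d v) z \<in> \<real>\<^sub>\<ge>\<^sub>0)"
proof -
  let ?T = "\<lambda>t. vec_index v 0 + (\<Sum>k=1..d. vec_index v k * cos (real k * t) - vec_index v (d + k) * sin (real k * t))"
  have "plus_vector d v \<longleftrightarrow> (\<forall>t\<in>{-pi<..pi}. ?T t \<ge> 0)"
    using assms by (simp add: plus_vector_def)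
  also have "\<dots> \<longleftrightarrow> (\<forall>t\<in>{-pi<..pi}. cnj (cis t) ^ d * poly (plus_poly d v) (cis t) \<in> \<real>\<^sub>\<ge>\<^sub>0)"
    by (simp only: poly_plus_poly_cis nonneg_Reals_of_real_iff)
  also have "\<dots> \<longleftrightarrow> (\<forall>z. cmod z = 1 \<longrightarrow> cnj z ^ d * poly (plus_poly d v) z \<in> \<real>\<^sub>\<ge>\<^sub>0)"
  proof (intro iffI allI impI ballI)
    fix z assume h: "\<forall>t\<in>{-pi<..pi}. cnj (cis t) ^ d * poly (plus_poly d v) (cis t) \<in> \<real>\<^sub>\<ge>\<^sub>0" and "cmod z = 1"
    then have "cis (Arg z) = z" by (simp add: cis_Arg_unit)
    then show "cnj z ^ d * poly (plus_poly d v) z \<in> \<real>\<^sub>\<ge>\<^sub>0"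
      using bspec[OF h, of "Arg z"] Arg_bounded[of z] by simp
  qed simp
  finally show ?thesis .
qed

lemma plus_poly_smult:
  assumes "v \<in> carrier_vec (2 * d + 1)"
  shows "plus_poly d (c \<cdot>\<^sub>v v) = smult (of_real c) (plus_poly d v)"
proof (rule poly_eqI)
  fix j
  have "vec_index (c \<cdot>\<^sub>v v) i = c * vec_index v i" if "i < 2 * d + 1" for i
    using assms that by simp
  then show "coeff (plus_poly d (c \<cdot>\<^sub>v v)) j = coeff (smult (of_real c) (plus_poly d v)) j"
    by (auto simp: coeff_plus_poly complex_eq_iff simp del: index_smult_vec)
qed

lemma plus_poly_inject:
  assumes "v \<in> carrier_vec (2 * d + 1)" "w \<in> carrier_vec (2 * d + 1)" "plus_poly d v = plus_poly d w"
  shows "v = w"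
proof (rule eq_vecI)
  show "dim_vec v = dim_vec w" using assms by simp
  fix i assume "i < dim_vec w"
  then consider "i = 0" | "1 \<le> i" "i \<le> d" | "d < i" "i \<le> 2 * d" using assms(2) by force
  then show "vec_index v i = vec_index w i"
  proof cases
    case 1
    then show ?thesis using arg_cong[OF assms(3), of "\<lambda>q. coeff q d"] by (simp add: coeff_plus_poly)
  next
    case 2
    then show ?thesis using arg_cong[OF assms(3), of "\<lambda>q. coeff q (d + i)"] by (simp add: coeff_plus_poly)
  next
    case 3
    then show ?thesis using arg_cong[OF assms(3), of "\<lambda>q. coeff q i"] by (simp add: coeff_plus_poly)
  qed
qed

text \<open>A real-valued \<open>cnj z\<^sup>d q z\<close> makes \<open>q\<close> self-reversed, so \<open>q\<close> is determined by its coefficients from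
  degree \<open>d\<close> upwards.\<close>

lemma plus_poly_surj:
  assumes deg: "degree q \<le> 2 * d"
    and nonneg: "\<And>z. cmod z = 1 \<Longrightarrow> cnj z ^ d * poly q z \<in> \<real>\<^sub>\<ge>\<^sub>0"
  obtains v where "v \<in> carrier_vec (2 * d + 1)" "plus_poly d v = q"
proof -
  have "star (2 * d) q = q"
  proof (rule poly_eqI_circle)
    fix z :: complex assume z: "cmod z = 1"
    then have zz: "z * cnj z = 1" by (simp add: complex_norm_square[symmetric])
    have "cnj (cnj z ^ d * poly q z) = cnj z ^ d * poly q z"
      using nonneg[OF z] by (metis nonneg_Reals_cases complex_cnj_complex_of_real)
    then have "z ^ d * cnj (poly q z) = cnj z ^ d * poly q z" by simp
    then have "z ^ (2 * d) * cnj (poly q z) = z ^ d * (cnj z ^ d * poly q z)"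
      by (simp only: mult_2 power_add mult.assoc)
    also have "\<dots> = (z * cnj z) ^ d * poly q z" by (simp add: power_mult_distrib)
    finally show "poly (star (2 * d) q) z = poly q z"
      using z deg zz by (simp add: poly_star_circle)
  qed
  then have sym: "cnj (coeff q (2 * d - j)) = coeff q j" if "j \<le> 2 * d" for j
    using that coeff_star[of "2 * d" q j] by simp
  define v where "v = Matrix.vec (2 * d + 1) (\<lambda>i. if i = 0 then Re (coeff q d)
     else if i \<le> d then 2 * Re (coeff q (d + i)) else 2 * Im (coeff q i))"
  have v: "v \<in> carrier_vec (2 * d + 1)" by (simp add: v_def)
  have "plus_poly d v = q"
  proof (rule poly_eqI)
    fix j
    consider "j = d" | "d < j" "j \<le> 2 * d" | "j < d" | "j > 2 * d" by linarith
    then show "coeff (plus_poly d v) j = coeff q j"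
    proof cases
      case 1
      then show ?thesis using sym[of d] by (simp add: coeff_plus_poly v_def complex_eq_iff)
    next
      case 2
      then have "j - d \<le> d" "0 < j - d" by auto
      then show ?thesis using 2 by (simp add: coeff_plus_poly v_def complex_eq_iff)
    next
      case 3
      then have "d + (d - j) = 2 * d - j" "0 < d - j" "d - j \<le> d" "d < 2 * d - j" "2 * d - j < 2 * d + 1" by auto
      then show ?thesis using 3 sym[of j] by (simp add: coeff_plus_poly v_def complex_eq_iff)
    next
      case 4
      then show ?thesis using deg by (simp add: coeff_plus_poly coeff_eq_0)
    qed
  qed
  with v show ?thesis by (rule that)
qed

lemma lin_indpt_singleton:
  assumes "w \<in> carrier_vec n" "w \<noteq> 0\<^sub>v n"
  shows "\<not> LinearCombinations.module.lin_dep class_ring (module_vec TYPE(real) n) {w}"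
proof -
  interpret V: vec_space "TYPE(real)" n .
  show ?thesis
  proof (rule V.finite_lin_indpt2)
    show "\<forall>v\<in>{w}. a v = 0" if "V.lincomb a {w} = 0\<^sub>v n" for a
    proof -
      have "V.lincomb a {w} = a w \<cdot>\<^sub>v w"
        using V.lincomb_insert2[of "{}" a w] assms(1) by simp
      then have "a w * vec_index w i = 0" if "i < n" for i
        using \<open>V.lincomb a {w} = 0\<^sub>v n\<close> that assms(1) by (metis carrier_vecD index_smult_vec(1) index_zero_vec(1))
      moreover obtain i where "i < n" "vec_index w i \<noteq> 0"
        using assms by (metis carrier_vecD eq_vecI index_zero_vec)
      ultimately show ?thesis by auto
    qed
  qed (use assms in auto)
qed

lemma lin_dep_pair:
  assumes v: "v \<in> carrier_vec n" and w: "w \<in> carrier_vec n" "w \<noteq> 0\<^sub>v n" and "v \<noteq> w"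
    and dep: "LinearCombinations.module.lin_dep class_ring (module_vec TYPE(real) n) {v, w}"
  shows "\<exists>c. v = c \<cdot>\<^sub>v w"
proof -
  interpret V: vec_space "TYPE(real)" n .
  obtain a u where a: "V.lincomb a {v, w} = 0\<^sub>v n" "u \<in> {v, w}" "a u \<noteq> 0"
    using V.finite_lin_dep[OF _ dep] v w by auto
  have "V.lincomb a {w} = a w \<cdot>\<^sub>v w"
    using V.lincomb_insert2[of "{}" a w] w(1) by simp
  then have "V.lincomb a {v, w} = a v \<cdot>\<^sub>v v + a w \<cdot>\<^sub>v w"
    using V.lincomb_insert2[of "{w}" a v] v w(1) assms(4) by simp
  then have eq: "a v * vec_index v i + a w * vec_index w i = 0" if "i < n" for i
    using a(1) that v w(1) by (metis carrier_vecD index_add_vec(1) index_smult_vec index_zero_vec(1))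
  have "a v \<noteq> 0"
  proof
    assume z: "a v = 0"
    then have "a w \<noteq> 0" using a by auto
    then have "vec_index w i = 0" if "i < n" for i using eq[OF that] z by simp
    then have "w = 0\<^sub>v n" using w(1) by (intro eq_vecI) auto
    then show False using w(2) by simp
  qed
  then have "v = (- a w / a v) \<cdot>\<^sub>v w"
    using eq v w(1) by (intro eq_vecI) (auto simp: field_simps eq_neg_iff_add_eq_0)
  then show ?thesis by blast
qed

lemma lin_dep_if_multiples:
  assumes w: "w \<in> carrier_vec n" and S: "a \<cdot>\<^sub>v w \<in> S" "b \<cdot>\<^sub>v w \<in> S" and ne: "a \<cdot>\<^sub>v w \<noteq> b \<cdot>\<^sub>v w"
  shows "LinearCombinations.module.lin_dep class_ring (module_vec TYPE(real) n) S"
proof -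
  interpret V: vec_space "TYPE(real)" n .
  define u where "u = a \<cdot>\<^sub>v w"
  define v where "v = b \<cdot>\<^sub>v w"
  define f where "f x = (if x = u then b else - a)" for x
  have uv: "u \<in> carrier_vec n" "v \<in> carrier_vec n" "u \<noteq> v" using w ne by (auto simp: u_def v_def)
  have "V.lincomb f {v} = f v \<cdot>\<^sub>v v"
    using V.lincomb_insert2[of "{}" f v] uv by simp
  then have "V.lincomb f {u, v} = b \<cdot>\<^sub>v u + (- a) \<cdot>\<^sub>v v"
    using V.lincomb_insert2[of "{v}" f u] uv by (simp add: f_def)
  also have "\<dots> = 0\<^sub>v n" using w by (intro eq_vecI) (auto simp: u_def v_def)
  finally have l: "V.lincomb f {u, v} = 0\<^sub>v n" .
  show ?thesis
  proof (cases "a = 0")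
    case False
    then show ?thesis
      by (intro V.lin_dep_crit[of "{u, v}" S v f]) (use uv S l in \<open>auto simp: f_def u_def v_def\<close>)
  next
    case True
    then have "u = 0\<^sub>v n" using w by (intro eq_vecI) (auto simp: u_def)
    then show ?thesis using S(1) by (intro V.zero_lin_dep) (auto simp: u_def)
  qed
qed

text \<open>The plus-dimension is at least 1 because of \<open>w\<close>, and it is at least 2 iff some plus-vector in \<open>V\<close>
  is not a multiple of \<open>w\<close>.\<close>

lemma dim_plus_eq_1_iff:
  assumes w: "w \<in> V" "plus_vector d w" "w \<noteq> 0\<^sub>v (2 * d + 1)"
  shows "dim_plus d V = 1 \<longleftrightarrow> (\<forall>v\<in>V. plus_vector d v \<longrightarrow> (\<exists>c. v = c \<cdot>\<^sub>v w))"
proof -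
  let ?n = "2 * d + 1"
  let ?dep = "LinearCombinations.module.lin_dep class_ring (module_vec TYPE(real) (2 * d + 1))"
  let ?ok = "\<lambda>S. finite S \<and> S \<subseteq> V \<and> (\<forall>v\<in>S. plus_vector d v) \<and> \<not> ?dep S"
  define T where "T = {card S | S. ?ok S}"
  interpret V: vec_space "TYPE(real)" ?n .
  have dim: "dim_plus d V = Max T" by (simp add: dim_plus_def T_def)
  have carr: "v \<in> carrier_vec ?n" if "plus_vector d v" for v using that by (simp add: plus_vector_def)
  have fin: "finite T"
  proof (rule finite_subset)
    show "T \<subseteq> {..?n}"
    proof
      fix x assume "x \<in> T"
      then obtain S where S: "x = card S" "?ok S" unfolding T_def by blast
      then have "S \<subseteq> carrier_vec ?n" using carr by auto
      then have "card S \<le> V.dim" using V.li_le_dim(2)[OF V.fin_dim] S(2) by simp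
      then show "x \<in> {..?n}" using S(1) V.dim_is_n by simp
    qed
  qed simp
  have w1: "?ok {w}" using w lin_indpt_singleton[OF carr[OF w(2)] w(3)] by simp
  then have 1: "1 \<in> T" unfolding T_def by (auto intro!: exI[of _ "{w}"])
  show ?thesis
  proof
    assume max: "dim_plus d V = 1"
    show "\<forall>v\<in>V. plus_vector d v \<longrightarrow> (\<exists>c. v = c \<cdot>\<^sub>v w)"
    proof (intro ballI impI)
      fix v assume v: "v \<in> V" "plus_vector d v"
      show "\<exists>c. v = c \<cdot>\<^sub>v w"
      proof (cases "v = w")
        case True
        then show ?thesis by (intro exI[of _ 1]) (simp add: one_smult_vec)
      next
        case False
        have "?dep {v, w}"
        proof (rule ccontr)
          assume "\<not> ?dep {v, w}"
          then have "?ok {v, w}" using v w by simp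
          then have "card {v, w} \<in> T" unfolding T_def by blast
          then have "card {v, w} \<le> 1" using Max_ge[OF fin] max dim by simp
          then show False using False by simp
        qed
        then show ?thesis using lin_dep_pair[OF carr[OF v(2)] carr[OF w(2)] w(3) False] by simp
      qed
    qed
  next
    assume mult: "\<forall>v\<in>V. plus_vector d v \<longrightarrow> (\<exists>c. v = c \<cdot>\<^sub>v w)"
    have "x \<le> 1" if xT: "x \<in> T" for x
    proof -
      obtain S where S: "x = card S" "?ok S" using xT unfolding T_def by blast
      have "u = v" if uv: "u \<in> S" "v \<in> S" for u v
      proof (rule ccontr)
        assume ne: "u \<noteq> v"
        obtain a where a: "u = a \<cdot>\<^sub>v w" using mult S(2) uv(1) by blast
        obtain b where b: "v = b \<cdot>\<^sub>v w" using mult S(2) uv(2) by blast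
        have cu: "u \<in> carrier_vec ?n" "v \<in> carrier_vec ?n" "w \<in> carrier_vec ?n"
          using S(2) uv w(2) carr by auto
        have "?dep S"
          by (rule lin_dep_if_multiples[OF cu(3) uv[unfolded a b] ne[unfolded a b]])
        then show False using S(2) by simp
      qed
      then have "card S \<le> 1" using S(2) by (metis card_le_Suc0_iff_eq One_nat_def)
      then show ?thesis using S(1) by simp
    qed
    then show "dim_plus d V = 1" unfolding dim using fin 1 by (intro Max_eqI) auto
  qed
qed

section \<open>The kernel of the matrix\<close>

lemma coeff_R_tilde_mult_monom:
  assumes p: "p \<noteq> 0" "degree p \<le> N"
  shows "coeff (R_tilde N p * monom c j) n = c * C_tilde N p (int n - int j)"
proof -
  have "coeff (R_tilde N p) i = 0" if "int i > s_tilde N p" for i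
    using degree_R_tilde[OF p] that by (intro coeff_eq_0) (simp add: s_tilde_def)
  then have C: "C_tilde N p i = (if 0 \<le> i then coeff (R_tilde N p) (nat i) else 0)" for i
    by (auto simp: C_tilde_def)
  have "coeff (R_tilde N p * monom c j) n = c * (if n < j then 0 else coeff (R_tilde N p) (n - j))"
    using coeff_monom_mult[of c j "R_tilde N p" n] by (simp add: mult.commute not_le[symmetric])
  moreover have "nat (int n - int j) = n - j" by simp
  ultimately show ?thesis by (auto simp: C)
qed

text \<open>The real and imaginary parts of the coefficients of \<open>R q\<close>, up to the factor 2, are the rows of the
  matrix applied to the vector of \<open>q\<close>.\<close>

lemma coeff_R_tilde_mult_plus_poly:
  fixes N :: nat and p :: "complex poly"
  defines "m \<equiv> m_tilde N p"
  assumes p: "p \<noteq> 0" "degree p \<le> N"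
  shows "2 * Re (coeff (R_tilde N p * plus_poly m v) n) = vec_index v 0 * A_plus N p n 0
          + (\<Sum>l=1..m. vec_index v l * A_plus N p n l + vec_index v (m + l) * B_minus N p n l)" (is ?Re)
    and "2 * Im (coeff (R_tilde N p * plus_poly m v) n) = vec_index v 0 * B_plus N p n 0
          + (\<Sum>l=1..m. vec_index v l * B_plus N p n l - vec_index v (m + l) * A_minus N p n l)" (is ?Im)
proof -
  define c where "c l = Complex (vec_index v l / 2) (vec_index v (m + l) / 2)" for l
  let ?C = "C_tilde N p"
  have cnj: "Complex (vec_index v l / 2) (- vec_index v (m + l) / 2) = cnj (c l)" for l
    by (simp add: c_def complex_eq_iff)
  have "coeff (R_tilde N p * plus_poly m v) n = of_real (vec_index v 0) * ?C (int n - int m)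
      + (\<Sum>l=1..m. c l * ?C (int n - int (m + l)) + cnj (c l) * ?C (int n - int (m - l)))"
    unfolding plus_poly_def cnj c_def[symmetric] distrib_left sum_distrib_left coeff_add coeff_sum
      coeff_R_tilde_mult_monom[OF p] ..
  also have "\<dots> = of_real (vec_index v 0) * ?C (int n - int m)
      + (\<Sum>l=1..m. c l * ?C (int n - int l - int m) + cnj (c l) * ?C (int n + int l - int m))"
  proof (intro arg_cong2[where f = "(+)"] refl sum.cong)
    fix l assume "l \<in> {1..m}"
    then have "int n - int (m + l) = int n - int l - int m" "int n - int (m - l) = int n + int l - int m" by auto
    then show "c l * ?C (int n - int (m + l)) = c l * ?C (int n - int l - int m)"
      "cnj (c l) * ?C (int n - int (m - l)) = cnj (c l) * ?C (int n + int l - int m)" by (simp_all only:)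
  qed
  finally have eq: "coeff (R_tilde N p * plus_poly m v) n = of_real (vec_index v 0) * ?C (int n - int m)
      + (\<Sum>l=1..m. c l * ?C (int n - int l - int m) + cnj (c l) * ?C (int n + int l - int m))" .
  have re: "2 * Re (c l * x + cnj (c l) * y) = vec_index v l * (Re y + Re x) + vec_index v (m + l) * (Im y - Im x)"
    and im: "2 * Im (c l * x + cnj (c l) * y) = vec_index v l * (Im y + Im x) - vec_index v (m + l) * (Re y - Re x)" for l x y
    by (simp_all add: c_def algebra_simps)
  have split: "2 * Re (of_real a * x + sum g {1..m}) = a * (Re x + Re x) + (\<Sum>l=1..m. 2 * Re (g l))"
    "2 * Im (of_real a * x + sum g {1..m}) = a * (Im x + Im x) + (\<Sum>l=1..m. 2 * Im (g l))" for a x and g :: "nat \<Rightarrow> complex"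
    by (simp_all add: sum_distrib_left)
  show ?Re unfolding eq split re
    by (simp add: A_plus_def B_minus_def A_tilde_def B_tilde_def m_def[symmetric])
  show ?Im unfolding eq split im
    by (simp add: B_plus_def A_minus_def A_tilde_def B_tilde_def m_def[symmetric])
qed

lemma sum_lessThan_odd:
  fixes f :: "nat \<Rightarrow> 'a :: comm_monoid_add"
  shows "(\<Sum>j\<in>{0..<2 * m + 1}. f j) = f 0 + (\<Sum>l=1..m. f l + f (m + l))"
proof -
  have "(\<Sum>l=1..m. f (m + l)) = sum f {m + 1..2 * m}"
    by (rule sum.reindex_bij_witness[of _ "\<lambda>j. j - m" "\<lambda>l. m + l"]) auto
  moreover have "{0..<2 * m + 1} = insert 0 ({1..m} \<union> {m + 1..2 * m})" by auto
  moreover have "sum f ({1..m} \<union> {m + 1..2 * m}) = sum f {1..m} + sum f {m + 1..2 * m}"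
    by (rule sum.union_disjoint) auto
  ultimately show ?thesis by (simp add: sum.distrib)
qed

lemma mat_kernel_M_tilde_iff:
  fixes N :: nat and p :: "complex poly"
  defines "m \<equiv> m_tilde N p"
  assumes p: "p \<noteq> 0" "degree p \<le> N" and v: "v \<in> carrier_vec (2 * m + 1)"
  shows "v \<in> mat_kernel (M_tilde N M k p) \<longleftrightarrow>
    (\<forall>j\<in>{1..M}. coeff (R_tilde N p * plus_poly m v) (k j) = 0)"
proof -
  let ?A = "M_tilde N M k p" and ?c = "\<lambda>j. coeff (R_tilde N p * plus_poly m v) (k j)"
  have carr: "?A \<in> carrier_mat (2 * M) (2 * m + 1)"
  proof -
    have "?A \<in> carrier_mat (M + M) (m + 1 + m)"
      unfolding M_tilde_def Let_def m_def[symmetric] by (rule four_block_carrier_mat) auto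
    then show ?thesis by (simp add: mult_2)
  qed
  have sp: "vec_index (?A *\<^sub>v v) i = (\<Sum>j\<in>{0..<2 * m + 1}. ?A $$ (i, j) * vec_index v j)" if "i < 2 * M" for i
    using that carr v by (auto simp: scalar_prod_def intro!: sum.cong)
  have ent: "?A $$ (i, j) = (if i < M then if j < m + 1 then A_plus N p (k (i + 1)) j else B_minus N p (k (i + 1)) (j - m)
      else if j < m + 1 then B_plus N p (k (i - M + 1)) j else - A_minus N p (k (i - M + 1)) (j - m))"
    if "i < 2 * M" "j < 2 * m + 1" for i j
    using that by (auto simp: M_tilde_def Let_def m_def[symmetric] Suc_diff_Suc)
  have up: "vec_index (?A *\<^sub>v v) i = 2 * Re (?c (i + 1))" if i: "i < M" for i
  proof -
    have "vec_index (?A *\<^sub>v v) i = (\<Sum>j\<in>{0..<2 * m + 1}.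
        (if j < m + 1 then A_plus N p (k (i + 1)) j else B_minus N p (k (i + 1)) (j - m)) * vec_index v j)"
      using i by (subst sp) (auto simp: ent intro!: sum.cong)
    also have "\<dots> = 2 * Re (?c (i + 1))"
      unfolding sum_lessThan_odd coeff_R_tilde_mult_plus_poly(1)[OF p, folded m_def]
      by (auto simp: mult.commute intro!: sum.cong)
    finally show ?thesis .
  qed
  have lo: "vec_index (?A *\<^sub>v v) (M + i) = 2 * Im (?c (i + 1))" if i: "i < M" for i
  proof -
    have "vec_index (?A *\<^sub>v v) (M + i) = (\<Sum>j\<in>{0..<2 * m + 1}.
        (if j < m + 1 then B_plus N p (k (i + 1)) j else - A_minus N p (k (i + 1)) (j - m)) * vec_index v j)"
      using i by (subst sp) (auto simp: ent intro!: sum.cong)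
    also have "\<dots> = 2 * Im (?c (i + 1))"
      unfolding sum_lessThan_odd coeff_R_tilde_mult_plus_poly(2)[OF p, folded m_def]
      by (auto simp: mult.commute intro!: sum.cong)
    finally show ?thesis .
  qed
  have "v \<in> mat_kernel ?A \<longleftrightarrow> (\<forall>i<2 * M. vec_index (?A *\<^sub>v v) i = 0)"
    unfolding mat_kernel[OF carr] using v carr by (auto simp: vec_eq_iff)
  also have "\<dots> \<longleftrightarrow> (\<forall>i<M. vec_index (?A *\<^sub>v v) i = 0 \<and> vec_index (?A *\<^sub>v v) (M + i) = 0)"
  proof (intro iffI allI impI)
    fix i assume h: "\<forall>i<M. vec_index (?A *\<^sub>v v) i = 0 \<and> vec_index (?A *\<^sub>v v) (M + i) = 0" and "i < 2 * M"
    then show "vec_index (?A *\<^sub>v v) i = 0"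
      using spec[OF h, of i] spec[OF h, of "i - M"] by (cases "i < M") auto
  qed auto
  also have "\<dots> \<longleftrightarrow> (\<forall>i<M. ?c (i + 1) = 0)"
    by (simp add: up lo complex_eq_iff)
  also have "\<dots> \<longleftrightarrow> (\<forall>j\<in>{1..M}. ?c j = 0)"
  proof (intro iffI ballI allI impI)
    fix j assume h: "\<forall>i<M. ?c (i + 1) = 0" and "j \<in> {1..M}"
    then show "?c j = 0" using spec[OF h, of "j - 1"] by auto
  qed auto
  finally show ?thesis .
qed

lemma polys_on_iff:
  assumes "finite \<Lambda>"
  shows "f \<in> polys_on \<Lambda> \<longleftrightarrow> (\<forall>n. n \<notin> \<Lambda> \<longrightarrow> coeff f n = 0)"
proof
  have co: "coeff (\<Sum>k\<in>\<Lambda>. monom (c k) k) n = (if n \<in> \<Lambda> then c n else 0)" for c :: "nat \<Rightarrow> complex" and n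
    using assms by (simp add: coeff_sum coeff_monom)
  {
    assume "f \<in> polys_on \<Lambda>"
    then show "\<forall>n. n \<notin> \<Lambda> \<longrightarrow> coeff f n = 0" unfolding polys_on_def using co by auto
  next
    assume "\<forall>n. n \<notin> \<Lambda> \<longrightarrow> coeff f n = 0"
    then have "f = (\<Sum>k\<in>\<Lambda>. monom (coeff f k) k)" by (intro poly_eqI) (auto simp: co)
    then show "f \<in> polys_on \<Lambda>" unfolding polys_on_def by blast
  }
qed

theorem theorem3p1:
  fixes N M :: nat and k :: "nat \<Rightarrow> nat" and \<Lambda> :: "nat set" and p :: "complex poly"
  assumes "N > 0"
    and "\<And>j. j \<in> {1..M} \<Longrightarrow> 0 < k j \<and> k j < N"
    and "strict_mono_on {1..M} k"
    and "\<Lambda> = {0..N} - k ` {1..M}"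
    and "p \<in> polys_on \<Lambda>"
    and "L1_norm p = 1"
  shows "exposed_point Polynomial.smult (polys_on \<Lambda>) L1_norm p \<longleftrightarrow>
         dim_plus (m_tilde N p) (mat_kernel (M_tilde N M k p)) = 1"
proof -
  let ?m = "m_tilde N p" and ?R = "R_tilde N p"
  let ?V = "mat_kernel (M_tilde N M k p)"
  have "finite \<Lambda>" using assms(4) by simp
  then have X_iff: "f \<in> polys_on \<Lambda> \<longleftrightarrow> degree f \<le> N \<and> (\<forall>j\<in>{1..M}. coeff f (k j) = 0)" for f
  proof -
    have "f \<in> polys_on \<Lambda> \<longleftrightarrow> (\<forall>n>N. coeff f n = 0) \<and> (\<forall>j\<in>{1..M}. coeff f (k j) = 0)"
      unfolding polys_on_iff[OF \<open>finite \<Lambda>\<close>] by (auto simp: assms(4))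
    then show ?thesis by (metis coeff_eq_0 degree_le le_less_trans)
  qed
  have p0: "p \<noteq> 0" using assms(6) by auto
  have pN: "degree p \<le> N" using X_iff assms(5) by blast
  note p = p0 pN
  have pRG: "p = ?R * G_tilde N p" by (rule p_eq_R_tilde_mult_G_tilde[OF p])
  then have R0: "?R \<noteq> 0" using p0 by auto
  have V: "v \<in> ?V \<longleftrightarrow> ?R * plus_poly ?m v \<in> polys_on \<Lambda>" if v: "plus_vector ?m v" for v
  proof -
    have carr: "v \<in> carrier_vec (2 * ?m + 1)" using v by (simp add: plus_vector_def)
    have "degree (?R * plus_poly ?m v) \<le> N"
      using degree_mult_le[of ?R "plus_poly ?m v"] degree_plus_poly[of ?m v] degree_R_tilde[OF p] by linarith
    then show ?thesis using mat_kernel_M_tilde_iff[OF p carr] X_iff by simp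
  qed
  have al: "plus_vector ?m v \<longleftrightarrow> aligned (?R * plus_poly ?m v) p" if "v \<in> carrier_vec (2 * ?m + 1)" for v
    unfolding aligned_iff[OF p] plus_vector_iff[OF that] ..
  \<comment> \<open>Every \<open>f\<close> of the cone is \<open>R\<close> times the polynomial of a plus-vector in the kernel.\<close>
  have param: "\<exists>v\<in>?V. plus_vector ?m v \<and> f = ?R * plus_poly ?m v" if f: "f \<in> polys_on \<Lambda>" "aligned f p" for f
  proof -
    have "degree f \<le> N" using X_iff f(1) by blast
    then obtain q where q: "f = ?R * q" "degree q \<le> 2 * ?m" using aligned_factor[OF p _ f(2)] by blast
    have "\<And>z. cmod z = 1 \<Longrightarrow> cnj z ^ ?m * poly q z \<in> \<real>\<^sub>\<ge>\<^sub>0"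
      using f(2) unfolding q(1) aligned_iff[OF p] by blast
    then obtain v where v: "v \<in> carrier_vec (2 * ?m + 1)" "plus_poly ?m v = q"
      using plus_poly_surj[OF q(2)] by blast
    have "plus_vector ?m v" using al[OF v(1)] f(2) q(1) v(2) by simp
    then show ?thesis using V f(1) q(1) v(2) by blast
  qed
  have "aligned p p"
    unfolding aligned_def by (simp add: complex_norm_square[symmetric] del: of_real_power)
  then obtain w where w: "w \<in> ?V" "plus_vector ?m w" "p = ?R * plus_poly ?m w"
    using param[OF assms(5)] by blast
  have wc: "w \<in> carrier_vec (2 * ?m + 1)" using w(2) by (simp add: plus_vector_def)
  have w0: "w \<noteq> 0\<^sub>v (2 * ?m + 1)"
  proof
    assume "w = 0\<^sub>v (2 * ?m + 1)"
    then have "plus_poly ?m w = 0" by (intro poly_eqI) (auto simp: coeff_plus_poly complex_eq_iff)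
    then show False using w(3) p0 by simp
  qed
  have "exposed_point smult (polys_on \<Lambda>) L1_norm p \<longleftrightarrow>
      (\<forall>f\<in>polys_on \<Lambda>. aligned f p \<longrightarrow> (\<exists>c::real. f = smult (of_real c) p))"
    by (rule exposed_point_iff_aligned[OF _ _ assms(5,6)]) (auto simp: polys_on_iff[OF \<open>finite \<Lambda>\<close>])
  also have "\<dots> \<longleftrightarrow> (\<forall>v\<in>?V. plus_vector ?m v \<longrightarrow> (\<exists>c. v = c \<cdot>\<^sub>v w))"
  proof (intro iffI ballI impI)
    fix v assume R: "\<forall>f\<in>polys_on \<Lambda>. aligned f p \<longrightarrow> (\<exists>c::real. f = smult (of_real c) p)"
      and v: "v \<in> ?V" "plus_vector ?m v"
    have vc: "v \<in> carrier_vec (2 * ?m + 1)" using v(2) by (simp add: plus_vector_def)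
    obtain c :: real where "?R * plus_poly ?m v = smult (of_real c) p"
      using R V[OF v(2)] v al[OF vc] by blast
    then have "?R * plus_poly ?m v = ?R * plus_poly ?m (c \<cdot>\<^sub>v w)"
      using w(3) by (simp add: plus_poly_smult[OF wc])
    then have "plus_poly ?m v = plus_poly ?m (c \<cdot>\<^sub>v w)" using R0 by simp
    then have "v = c \<cdot>\<^sub>v w" using plus_poly_inject[OF vc] wc by simp
    then show "\<exists>c. v = c \<cdot>\<^sub>v w" by blast
  next
    fix f assume R: "\<forall>v\<in>?V. plus_vector ?m v \<longrightarrow> (\<exists>c. v = c \<cdot>\<^sub>v w)"
      and f: "f \<in> polys_on \<Lambda>" "aligned f p"
    obtain v where v: "v \<in> ?V" "plus_vector ?m v" "f = ?R * plus_poly ?m v"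
      using param[OF f] by blast
    then obtain c where "v = c \<cdot>\<^sub>v w" using R by blast
    then have "f = smult (of_real c) p"
      using v(3) w(3) by (simp add: plus_poly_smult[OF wc])
    then show "\<exists>c::real. f = smult (of_real c) p" by blast
  qed
  also have "\<dots> \<longleftrightarrow> dim_plus ?m ?V = 1" by (rule dim_plus_eq_1_iff[OF w(1,2) w0, symmetric])
  finally show ?thesis .
qed

end
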